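(* (a) Let $M_1,M_2$ be matroids. If $S$ is the ground set of a rank-$k$ intertwine of $M_1$ and $M_2$, then $$2k-r(M_1)-r(M_2)\le|S|\le 2k+r(M_1^* )+r(M_2^* ).$$ (b) Suppose moreover that $M_1,M_2$ have positive rank, have disjoint ground sets $S_1,S_2$, that no matroid isomorphic to $M_1$ can be obtained from $M_2$ by any combination of minors, free extensions and free coextensions and vice versa, and that $FI(M_i)=\emptyset=FI(M_i^* )$ for $i\in\{1,2\}$. Then for every integer $k\ge4\max\{|S_1|,|S_2|\}$ and every integer $m$ with $2k-r(M_1)-r(M_2)\le m\le 2k+r(M_1^* )+r(M_2^* )$, there are $S'_1\subseteq S_1$, $S'_2\subseteq S_2$ such that (for $T_1,T_2$ with $|T_1|=k-r(M_1)-|S'_2|$, $|T_2|=k-r(M_2)-|S'_1|$ and $T_1,T_2,S_1\cup S_2$ pairwise disjoint) the matroid $M_k(M_1,S'_1,T_1;M_2,S'_2,T_2)$ is a rank-$k$ intertwine of $M_1$ and $M_2$ on a ground set of exactly $m$ elements.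
   Context: All matroids are finite. A cyclic flat is a flat that is a (possibly empty) union of circuits; for a matroid $N$, $\mathcal{Z}'(N)$ denotes its set of nonempty proper cyclic flats, and $\eta_N(Y)=|Y|-r_N(Y)$ is the nullity. The free extension $N+x$ by a new element $x$ has as circuits those of $N$ together with $B\cup x$ for bases $B$ of $N$; the free coextension is $N\times x=(N^*+x)^*$. $FI(N)$ is the set of elements of $N$ lying in no proper cyclic flat (free elements and isthmuses); $FI(N^* )$ is the intersection of all nonempty cyclic flats (cofree elements and loops). A matroid $M$ is an intertwine of $N_1$ and $N_2$ if $M$ has minors isomorphic to $N_1$ and to $N_2$, but no proper minor of $M$ has both. Construction $M_k(N_1,A_1,U_1;N_2,A_2,U_2)$: let $N_1,N_2$ be matroids of positive rank on disjoint ground sets $R_1,R_2$ with rank functions $\rho_1,\rho_2$; let $A_1\subseteq R_1$, $A_2\subseteq R_2$; let $k$ be an integer with $k\ge r(N_1)+\eta_{N_1}(A_1)+r(N_2)+\eta_{N_2}(A_2)$; and let $U_1,U_2$ be sets with $|U_1|=k-r(N_1)-|A_2|$, $|U_2|=k-r(N_2)-|A_1|$, such that $U_1,U_2,R_1\cup R_2$ are pairwise disjoint. Let $E=R_1\cup R_2\cup U_1\cup U_2$. Then $M_k(N_1,A_1,U_1;N_2,A_2,U_2)$ is the (existing and unique) matroid on $E$ whose cyclic flats are exactly: $\emptyset$, of rank $0$; $E$, of rank $k$; the sets $F\cup U_1\cup A_2$ for $F\in\mathcal{Z}'(N_1)$, of rank $\rho_1(F)+|U_1|+|A_2|$; and the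 sets $F\cup U_2\cup A_1$ for $F\in\mathcal{Z}'(N_2)$, of rank $\rho_2(F)+|U_2|+|A_1|$. *)

theory Defs
  imports Main
begin

record 'a set_system =
  ground :: "'a set"
  indeps :: "'a set set"

locale matroid =
  fixes M :: "'a set_system"
  assumes finite_ground: "finite (ground M)"
    and indeps_subset: "I \<in> indeps M \<Longrightarrow> I \<subseteq> ground M"
    and empty_indep: "{} \<in> indeps M"
    and indep_mono: "I \<in> indeps M \<Longrightarrow> J \<subseteq> I \<Longrightarrow> J \<in> indeps M"
    and indep_augment: "I \<in> indeps M \<Longrightarrow> J \<in> indeps M \<Longrightarrow> card I < card J
      \<Longrightarrow> \<exists>x \<in> J - I. insert x I \<in> indeps M"

definition rank_on :: "'a set_system \<Rightarrow> 'a set \<Rightarrow> nat" where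
  "rank_on M X = Max (card ` {I \<in> indeps M. I \<subseteq> X})"

abbreviation rank_of :: "'a set_system \<Rightarrow> nat" where
  "rank_of M \<equiv> rank_on M (ground M)"

definition is_basis :: "'a set_system \<Rightarrow> 'a set \<Rightarrow> bool" where
  "is_basis M B \<longleftrightarrow> B \<in> indeps M \<and> (\<forall>I \<in> indeps M. B \<subseteq> I \<longrightarrow> I = B)"

definition circuits :: "'a set_system \<Rightarrow> 'a set set" where
  "circuits M = {C. C \<subseteq> ground M \<and> C \<notin> indeps M \<and> (\<forall>D. D \<subset> C \<longrightarrow> D \<in> indeps M)}"

definition is_flat :: "'a set_system \<Rightarrow> 'a set \<Rightarrow> bool" where
  "is_flat M F \<longleftrightarrow> F \<subseteq> ground M \<and> (\<forall>x \<in> ground M - F. rank_on M (insert x F) > rank_on M F)"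

definition is_cyclic_flat :: "'a set_system \<Rightarrow> 'a set \<Rightarrow> bool" where
  "is_cyclic_flat M F \<longleftrightarrow> is_flat M F \<and> (\<exists>\<C>. \<C> \<subseteq> circuits M \<and> F = \<Union>\<C>)"

definition proper_cyclic_flats :: "'a set_system \<Rightarrow> 'a set set" where
  "proper_cyclic_flats M = {F. is_cyclic_flat M F \<and> F \<noteq> {} \<and> F \<noteq> ground M}"

text \<open>The elements lying in no proper cyclic flat; the empty cyclic flat, if present,
  contains nothing and so makes no difference here.\<close>

definition FI :: "'a set_system \<Rightarrow> 'a set" where
  "FI M = ground M - \<Union>(proper_cyclic_flats M)"

definition dual_matroid :: "'a set_system \<Rightarrow> 'a set_system" where
  "dual_matroid M = \<lparr>ground = ground M,
     indeps = {I. \<exists>B. is_basis M B \<and> I \<subseteq> ground M - B}\<rparr>"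

definition delete_elems :: "'a set_system \<Rightarrow> 'a set \<Rightarrow> 'a set_system" where
  "delete_elems M X = \<lparr>ground = ground M - X, indeps = {I \<in> indeps M. I \<inter> X = {}}\<rparr>"

definition contract_elems :: "'a set_system \<Rightarrow> 'a set \<Rightarrow> 'a set_system" where
  "contract_elems M X = dual_matroid (delete_elems (dual_matroid M) X)"

definition minor_of :: "'a set_system \<Rightarrow> 'a set_system \<Rightarrow> bool" where
  "minor_of N M \<longleftrightarrow> (\<exists>X Y. X \<subseteq> ground M \<and> Y \<subseteq> ground M \<and> X \<inter> Y = {} \<and>
     N = delete_elems (contract_elems M X) Y)"

definition proper_minor_of :: "'a set_system \<Rightarrow> 'a set_system \<Rightarrow> bool" where
  "proper_minor_of N M \<longleftrightarrow> minor_of N M \<and> N \<noteq> M"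

definition matroid_iso :: "'a set_system \<Rightarrow> 'b set_system \<Rightarrow> bool" where
  "matroid_iso M N \<longleftrightarrow> (\<exists>f. bij_betw f (ground M) (ground N) \<and>
     (\<forall>X \<subseteq> ground M. X \<in> indeps M \<longleftrightarrow> f ` X \<in> indeps N))"

definition has_minor_iso :: "'a set_system \<Rightarrow> 'b set_system \<Rightarrow> bool" where
  "has_minor_iso M N \<longleftrightarrow> (\<exists>N'. minor_of N' M \<and> matroid_iso N' N)"

definition is_intertwine :: "'c set_system \<Rightarrow> 'a set_system \<Rightarrow> 'b set_system \<Rightarrow> bool" where
  "is_intertwine M N1 N2 \<longleftrightarrow> matroid M \<and> has_minor_iso M N1 \<and> has_minor_iso M N2 \<and>
     \<not> (\<exists>M'. proper_minor_of M' M \<and> has_minor_iso M' N1 \<and> has_minor_iso M' N2)"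

definition matroid_of_circuits :: "'a set \<Rightarrow> 'a set set \<Rightarrow> 'a set_system" where
  "matroid_of_circuits E \<C> = \<lparr>ground = E, indeps = {I. I \<subseteq> E \<and> \<not> (\<exists>C \<in> \<C>. C \<subseteq> I)}\<rparr>"

definition free_ext :: "'a set_system \<Rightarrow> 'a \<Rightarrow> 'a set_system" where
  "free_ext N x = matroid_of_circuits (insert x (ground N))
     (circuits N \<union> {insert x B | B. is_basis N B})"

definition free_coext :: "'a set_system \<Rightarrow> 'a \<Rightarrow> 'a set_system" where
  "free_coext N x = dual_matroid (free_ext (dual_matroid N) x)"

inductive obtainable_from :: "'a set_system \<Rightarrow> 'a set_system \<Rightarrow> bool" for M where
  start: "obtainable_from M M"
| minor: "obtainable_from M N \<Longrightarrow> minor_of N' N \<Longrightarrow> obtainable_from M N'"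
| ext: "obtainable_from M N \<Longrightarrow> x \<notin> ground N \<Longrightarrow> obtainable_from M (free_ext N x)"
| coext: "obtainable_from M N \<Longrightarrow> x \<notin> ground N \<Longrightarrow> obtainable_from M (free_coext N x)"

definition iso_obtainable_from :: "'a set_system \<Rightarrow> 'b set_system \<Rightarrow> bool" where
  "iso_obtainable_from M N \<longleftrightarrow> (\<exists>N'. obtainable_from M N' \<and> matroid_iso N' N)"

text \<open>A matroid is determined by its ground set and its cyclic flats together with their ranks;
  the set of pairs below prescribes both at once.  The description is meaningful (some matroid
  satisfies it) for matroids \<open>N1\<close>, \<open>N2\<close> of positive rank with disjoint ground sets,
  \<open>A1\<close>, \<open>A2\<close> subsets of those ground sets,
  \<open>k \<ge> r(N1) + \<eta>(A1) + r(N2) + \<eta>(A2)\<close> (\<open>\<eta>\<close> the nullity in \<open>N1\<close>, \<open>N2\<close> respectively),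
  and disjoint sets \<open>U1\<close>, \<open>U2\<close> of new elements with
  \<open>|U1| = k - r(N1) - |A2|\<close>, \<open>|U2| = k - r(N2) - |A1|\<close>.\<close>

definition M_construction ::
  "nat \<Rightarrow> 'a set_system \<Rightarrow> 'a set \<Rightarrow> 'a set \<Rightarrow> 'a set_system \<Rightarrow> 'a set \<Rightarrow> 'a set \<Rightarrow> 'a set_system"
where
  "M_construction k N1 A1 U1 N2 A2 U2 =
    (let E = ground N1 \<union> ground N2 \<union> U1 \<union> U2 in
     THE M. matroid M \<and> ground M = E \<and>
       {(Z, rank_on M Z) | Z. is_cyclic_flat M Z} =
         {({}, 0), (E, k)}
         \<union> {(F \<union> U1 \<union> A2, rank_on N1 F + card U1 + card A2) | F. F \<in> proper_cyclic_flats N1}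
         \<union> {(F \<union> U2 \<union> A1, rank_on N2 F + card U2 + card A1) | F. F \<in> proper_cyclic_flats N2})"

end

theory Submission
  imports Defs
begin

text \<open>Let \<open>M/X1\Y1\<close> and \<open>M/X2\Y2\<close> be copies of \<open>M1\<close> and \<open>M2\<close> in an intertwine \<open>M\<close>, with each
  \<open>Xi\<close> independent of size \<open>r(M) - r(Mi)\<close>. By minimality \<open>X1\<close>, \<open>X2\<close> are disjoint and so are
  \<open>Y1\<close>, \<open>Y2\<close>, which gives both bounds.

  For the construction, coextend \<open>M1\<close> freely by \<open>T1 \<union> S2\<close> and then extend it freely by the rest
  of the ground set; do the same with the roles of \<open>M1\<close> and \<open>M2\<close> exchanged. A set is independent
  in \<open>M_construction\<close> iff it is independent in both expansions: for \<open>k\<close> large, a set with fewer than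
  \<open>k\<close> elements cannot be tight for both, so augmentation is inherited. A copy of \<open>M1\<close> among the
  minors of this matroid deletes so many elements that one of the two families of constraints
  becomes vacuous. If the one from \<open>M1\<close> does, the copy is obtained from \<open>M2\<close> by minors, free
  extensions and free coextensions, which is excluded. Otherwise it is a minor of the expansion of
  \<open>M1\<close>, and the conditions on \<open>FI\<close> force the contracted set to be \<open>T1 \<union> S2\<close> and the deleted set
  to be the other added elements. These sets are disjoint from their counterparts for \<open>M2\<close>, so no
  proper minor contains copies of both. Every choice of \<open>S1\<close>, \<open>S2\<close> works; only
  \<open>|S1| + |S2|\<close> determines \<open>m\<close>.\<close>

section \<open>Ranks, circuits and cyclic flats\<close>

context matroid begin

section \<open>Rank of a set and extension of independent sets\<close>

lemma finite_indep: "I \<in> indeps M \<Longrightarrow> finite I"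
  by (rule finite_subset[OF indeps_subset finite_ground])

lemma finite_indeps: "finite (indeps M)"
  by (rule finite_subset[of _ "Pow (ground M)"]) (auto simp: finite_ground dest: indeps_subset)

lemma card_le_rank_on: "I \<in> indeps M \<Longrightarrow> I \<subseteq> X \<Longrightarrow> card I \<le> rank_on M X"
  unfolding rank_on_def by (rule Max_ge) (auto simp: finite_indeps)

lemma card_subset_le_rank_on:
  "I \<in> indeps M \<Longrightarrow> J \<subseteq> I \<Longrightarrow> J \<subseteq> X \<Longrightarrow> card J \<le> rank_on M X"
  using card_le_rank_on[OF indep_mono] .

lemma rank_on_witness: obtains B where "B \<in> indeps M" "B \<subseteq> X" "card B = rank_on M X"
proof -
  have "rank_on M X \<in> card ` {I \<in> indeps M. I \<subseteq> X}"
    unfolding rank_on_def by (rule Max_in) (auto simp: finite_indeps intro!: empty_indep)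
  then show ?thesis using that by auto
qed

lemma rank_on_le:
  assumes "\<And>I. I \<in> indeps M \<Longrightarrow> I \<subseteq> X \<Longrightarrow> card I \<le> n"
  shows "rank_on M X \<le> n"
proof -
  obtain I where "I \<in> indeps M" "I \<subseteq> X" "card I = rank_on M X"
    by (rule rank_on_witness)
  then show ?thesis using assms[of I] by simp
qed

lemma rank_on_mono: "X \<subseteq> Y \<Longrightarrow> rank_on M X \<le> rank_on M Y"
  by (rule rank_on_le) (use card_le_rank_on in blast)

lemma rank_on_le_card: "finite X \<Longrightarrow> rank_on M X \<le> card X"
  by (rule rank_on_le) (simp add: card_mono)

text \<open>A largest independent set between \<open>I\<close> and \<open>X\<close> exists by
  finiteness; if it were smaller than a rank witness of \<open>X\<close>, augmentation would enlarge
  it within \<open>X\<close>.\<close>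

lemma indep_extend:
  assumes "I \<in> indeps M" "I \<subseteq> X"
  obtains B where "B \<in> indeps M" "I \<subseteq> B" "B \<subseteq> X" "card B = rank_on M X"
proof -
  let ?S = "{J \<in> indeps M. I \<subseteq> J \<and> J \<subseteq> X}"
  have fin: "finite ?S" using finite_indeps by auto
  have ne: "?S \<noteq> {}" using assms by auto
  have "Max (card ` ?S) \<in> card ` ?S" using fin ne by (intro Max_in) auto
  then obtain B where B: "B \<in> ?S" "Max (card ` ?S) = card B" by (rule imageE) blast
  obtain A where A: "A \<in> indeps M" "A \<subseteq> X" "card A = rank_on M X"
    by (rule rank_on_witness)
  have "\<not> card B < card A"
  proof
    assume "card B < card A"
    then obtain x where x: "x \<in> A - B" "insert x B \<in> indeps M"
      using indep_augment A B by blast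
    then have "insert x B \<in> ?S" using A B by auto
    then have "card (insert x B) \<le> card B"
      unfolding B(2)[symmetric] using fin by (intro Max_ge) auto
    then show False using x B finite_indep by auto
  qed
  then have "card B = rank_on M X"
    using A B card_le_rank_on[of B X] by auto
  then show ?thesis using B that by auto
qed

lemma indep_iff_rank_on:
  assumes X: "X \<subseteq> ground M"
  shows "X \<in> indeps M \<longleftrightarrow> card X \<le> rank_on M X"
proof
  assume le: "card X \<le> rank_on M X"
  obtain B where B: "B \<in> indeps M" "B \<subseteq> X" "card B = rank_on M X"
    by (rule rank_on_witness)
  then have "B = X" using X le finite_subset[OF _ finite_ground] by (intro card_seteq) auto
  then show "X \<in> indeps M" using B by simp
qed (auto intro: card_le_rank_on)

lemma rank_on_indep: "I \<in> indeps M \<Longrightarrow> rank_on M I = card I"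
  by (intro antisym rank_on_le_card card_le_rank_on finite_indep) auto

text \<open>If the rank went up, a larger independent subset of \<open>insert x X\<close> would
  augment \<open>B\<close>. The new element cannot be \<open>x\<close>, so it lies in
  \<open>X\<close>, where \<open>B\<close> is already maximum.\<close>

lemma rank_on_insert_eqI:
  assumes "B \<in> indeps M" "B \<subseteq> X" "card B = rank_on M X" "x \<in> ground M"
    and "insert x B \<notin> indeps M"
  shows "rank_on M (insert x X) = rank_on M X"
proof (rule antisym)
  show "rank_on M (insert x X) \<le> rank_on M X"
  proof (rule ccontr)
    assume n: "\<not> ?thesis"
    obtain A where A: "A \<in> indeps M" "A \<subseteq> insert x X" "card A = rank_on M (insert x X)"
      by (rule rank_on_witness)
    obtain y where y: "y \<in> A - B" "insert y B \<in> indeps M"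
      using indep_augment[OF assms(1) A(1)] n A assms by auto
    then have "y \<in> X" using A assms by auto
    then have "card (insert y B) \<le> rank_on M X"
      using assms y by (intro card_le_rank_on) auto
    then show False using y assms finite_indep by auto
  qed
qed (auto intro: rank_on_mono)

lemma is_basis_iff: "is_basis M B \<longleftrightarrow> B \<in> indeps M \<and> card B = rank_of M"
proof
  assume B: "is_basis M B"
  then have i: "B \<in> indeps M" by (simp add: is_basis_def)
  obtain A where "A \<in> indeps M" "B \<subseteq> A" "card A = rank_of M"
    using indep_extend[OF i indeps_subset[OF i]] by metis
  then show "B \<in> indeps M \<and> card B = rank_of M" using B by (auto simp: is_basis_def)
next
  assume B: "B \<in> indeps M \<and> card B = rank_of M"
  show "is_basis M B" unfolding is_basis_def
  proof (intro conjI ballI impI)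
    fix I assume I: "I \<in> indeps M" "B \<subseteq> I"
    then have "card I \<le> card B" using B card_le_rank_on[OF I(1) indeps_subset[OF I(1)]] by simp
    then show "I = B" using card_seteq[OF finite_indep[OF I(1)] I(2)] by simp
  qed (use B in simp)
qed

section \<open>Circuits and removal of their elements\<close>

lemma dependent_contains_circuit:
  assumes "X \<subseteq> ground M" "X \<notin> indeps M"
  obtains C where "C \<in> circuits M" "C \<subseteq> X"
proof -
  have "finite X" using assms(1) finite_ground by (rule finite_subset)
  from this assms have "\<exists>C \<in> circuits M. C \<subseteq> X"
  proof (induction X rule: finite_psubset_induct)
    case (psubset X)
    show ?case
    proof (cases "\<forall>D. D \<subset> X \<longrightarrow> D \<in> indeps M")
      case True
      then show ?thesis using psubset.prems by (auto simp: circuits_def)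
    next
      case False
      then obtain D where "D \<subset> X" "D \<notin> indeps M" by auto
      then show ?thesis using psubset.IH[of D] psubset.prems by blast
    qed
  qed
  then show ?thesis using that by auto
qed

lemma circuit_remove_indep: "C \<in> circuits M \<Longrightarrow> c \<in> C \<Longrightarrow> C - {c} \<in> indeps M"
  by (auto simp: circuits_def)

lemma finite_circuit: "C \<in> circuits M \<Longrightarrow> finite C"
  using finite_ground finite_subset by (auto simp: circuits_def)

lemma circuit_nonempty: "C \<in> circuits M \<Longrightarrow> C \<noteq> {}"
  using empty_indep by (auto simp: circuits_def)

lemma card_circuit: "C \<in> circuits M \<Longrightarrow> card C = Suc (rank_on M C)"
proof -
  assume C: "C \<in> circuits M"
  then obtain c where c: "c \<in> C" using circuit_nonempty by auto
  have 1: "C - {c} \<in> indeps M" using C c circuit_remove_indep by auto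
  have 2: "card (C - {c}) \<le> rank_on M C" using 1 by (intro card_le_rank_on) auto
  have "\<not> card C \<le> rank_on M C" using C indep_iff_rank_on by (auto simp: circuits_def)
  then show ?thesis using 2 c finite_circuit[OF C] by (simp add: card_Diff_singleton)
qed

text \<open>Adding \<open>x\<close> to a maximum independent subset of \<open>Z - {x}\<close>
  creates a dependent set, and every circuit in it uses \<open>x\<close>.\<close>

lemma circuit_through:
  assumes "Z \<subseteq> ground M" "x \<in> Z" "rank_on M (Z - {x}) = rank_on M Z"
  obtains C where "C \<in> circuits M" "x \<in> C" "C \<subseteq> Z"
proof -
  obtain B where B: "B \<in> indeps M" "B \<subseteq> Z - {x}" "card B = rank_on M (Z - {x})"
    by (rule rank_on_witness)
  have "insert x B \<notin> indeps M"
  proof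
    assume "insert x B \<in> indeps M"
    moreover have "insert x B \<subseteq> Z" using B assms by auto
    ultimately have "card (insert x B) \<le> rank_on M Z" by (rule card_le_rank_on)
    moreover have "x \<notin> B" using B by auto
    ultimately show False using B assms finite_indep by auto
  qed
  moreover have "insert x B \<subseteq> ground M" using B assms by auto
  ultimately obtain C where C: "C \<in> circuits M" "C \<subseteq> insert x B"
    using dependent_contains_circuit by metis
  have "x \<in> C"
  proof (rule ccontr)
    assume "x \<notin> C"
    then have "C \<in> indeps M" using indep_mono[OF B(1), of C] C(2) B(2) by auto
    then show False using C by (auto simp: circuits_def)
  qed
  then show ?thesis using C B assms that by blast
qed

text \<open>\<open>C - {x}\<close> extends to a maximum independent subset of \<open>Z\<close>; this
  avoids \<open>x\<close>, as it would otherwise contain \<open>C\<close>, and so it survives in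
  \<open>Z - {x}\<close>.\<close>

lemma rank_on_remove_circuit:
  assumes "C \<in> circuits M" "x \<in> C" "C \<subseteq> Z"
  shows "rank_on M (Z - {x}) = rank_on M Z"
proof (rule antisym)
  have "C - {x} \<subseteq> Z" using assms by auto
  then obtain B where B: "B \<in> indeps M" "C - {x} \<subseteq> B" "B \<subseteq> Z" "card B = rank_on M Z"
    using indep_extend[OF circuit_remove_indep[OF assms(1,2)]] by metis
  have "x \<notin> B"
  proof
    assume "x \<in> B"
    then have "C \<in> indeps M" using indep_mono[OF B(1), of C] B(2) by auto
    then show False using assms by (auto simp: circuits_def)
  qed
  then show "rank_on M Z \<le> rank_on M (Z - {x})"
    using B by (metis card_le_rank_on subset_Diff_insert Diff_empty)
qed (auto intro: rank_on_mono)

lemma circuit_subset_ground: "C \<in> circuits M \<Longrightarrow> C \<subseteq> ground M"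
  by (simp add: circuits_def)

text \<open>Turns cyclicity into a condition on ranks alone, so that cyclic flats of a constructed
  matroid can be recognised by computing ranks. The converse covers each removable element by a
  circuit from \<open>circuit_through\<close>.\<close>

lemma union_of_circuits_iff:
  "(\<exists>\<C>. \<C> \<subseteq> circuits M \<and> F = \<Union>\<C>) \<longleftrightarrow>
    F \<subseteq> ground M \<and> (\<forall>x \<in> F. rank_on M (F - {x}) = rank_on M F)" (is "?L \<longleftrightarrow> ?R")
proof
  assume ?L
  then obtain \<C> where \<C>: "\<C> \<subseteq> circuits M" "F = \<Union>\<C>" by blast
  have "rank_on M (F - {x}) = rank_on M F" if xF: "x \<in> F" for x
  proof -
    obtain C where "C \<in> \<C>" "x \<in> C" using \<C> xF by blast
    then show ?thesis using \<C> by (intro rank_on_remove_circuit[of C]) auto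
  qed
  then show ?R using \<C> circuit_subset_ground by blast
next
  assume R: ?R
  have "F = \<Union>{C \<in> circuits M. C \<subseteq> F}"
  proof
    show "F \<subseteq> \<Union>{C \<in> circuits M. C \<subseteq> F}"
    proof
      fix x assume "x \<in> F"
      then obtain C where "C \<in> circuits M" "x \<in> C" "C \<subseteq> F"
        using circuit_through R by metis
      then show "x \<in> \<Union>{C \<in> circuits M. C \<subseteq> F}" by auto
    qed
  qed auto
  then show ?L by (intro exI[of _ "{C \<in> circuits M. C \<subseteq> F}"]) auto
qed

lemma is_cyclic_flat_iff:
  "is_cyclic_flat M F \<longleftrightarrow>
    is_flat M F \<and> (\<forall>x \<in> F. rank_on M (F - {x}) = rank_on M F)"
  unfolding is_cyclic_flat_def union_of_circuits_iff by (auto simp: is_flat_def)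

section \<open>Closure and cyclic flats\<close>

definition cl :: "'a set \<Rightarrow> 'a set" where
  "cl X = {x \<in> ground M. rank_on M (insert x X) = rank_on M X}"

lemma cl_subset_ground: "cl X \<subseteq> ground M"
  by (auto simp: cl_def)

lemma subset_cl: "X \<subseteq> ground M \<Longrightarrow> X \<subseteq> cl X"
  by (auto simp: cl_def insert_absorb)

lemma insert_dependent_if_cl:
  "x \<in> cl X \<Longrightarrow> x \<notin> B \<Longrightarrow> B \<subseteq> X \<Longrightarrow> card B = rank_on M X \<Longrightarrow> insert x B \<notin> indeps M"
proof
  assume *: "x \<in> cl X" "x \<notin> B" "B \<subseteq> X" "card B = rank_on M X" "insert x B \<in> indeps M"
  then have "card (insert x B) \<le> rank_on M (insert x X)" by (intro card_le_rank_on) auto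
  moreover have "finite B" using finite_indep[OF *(5)] by auto
  ultimately show False using * by (auto simp: cl_def)
qed

lemma rank_on_cl: "X \<subseteq> ground M \<Longrightarrow> rank_on M (cl X) = rank_on M X"
proof (rule antisym)
  assume X: "X \<subseteq> ground M"
  obtain B where B: "B \<in> indeps M" "B \<subseteq> X" "card B = rank_on M X"
    by (rule rank_on_witness)
  show "rank_on M (cl X) \<le> rank_on M X"
  proof (rule ccontr)
    assume n: "\<not> ?thesis"
    obtain A where A: "A \<in> indeps M" "A \<subseteq> cl X" "card A = rank_on M (cl X)"
      by (rule rank_on_witness)
    obtain y where "y \<in> A - B" "insert y B \<in> indeps M"
      using indep_augment[OF B(1) A(1)] n A B by auto
    then show False using insert_dependent_if_cl A B by blast
  qed
qed (auto intro: rank_on_mono dest: subset_cl)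

lemma is_flat_cl: "X \<subseteq> ground M \<Longrightarrow> is_flat M (cl X)"
  unfolding is_flat_def
proof (intro conjI ballI)
  fix x assume X: "X \<subseteq> ground M" and x: "x \<in> ground M - cl X"
  have "rank_on M X < rank_on M (insert x X)"
    using x rank_on_mono[of X "insert x X"] by (force simp: cl_def)
  also have "\<dots> \<le> rank_on M (insert x (cl X))" using subset_cl[OF X] by (intro rank_on_mono) auto
  finally show "rank_on M (cl X) < rank_on M (insert x (cl X))" using rank_on_cl[OF X] by simp
qed (rule cl_subset_ground)

lemma is_cyclic_flat_cl_circuit:
  assumes C: "C \<in> circuits M"
  shows "is_cyclic_flat M (cl C)"
  unfolding is_cyclic_flat_iff
proof (intro conjI ballI)
  have CE: "C \<subseteq> ground M" using C by (auto simp: circuits_def)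
  show "is_flat M (cl C)" using CE by (rule is_flat_cl)
  fix x assume x: "x \<in> cl C"
  show "rank_on M (cl C - {x}) = rank_on M (cl C)"
  proof (cases "x \<in> C")
    case True
    then show ?thesis using subset_cl[OF CE] by (intro rank_on_remove_circuit[OF C])
  next
    case False
    then have "rank_on M C \<le> rank_on M (cl C - {x})" using subset_cl[OF CE] by (intro rank_on_mono) auto
    then show ?thesis using rank_on_cl[OF CE] rank_on_mono[of "cl C - {x}" "cl C"] by auto
  qed
qed

text \<open>A dependent set meets the closure of any circuit it contains in too many elements.\<close>

lemma indep_iff_cyclic_flats:
  "I \<in> indeps M \<longleftrightarrow> I \<subseteq> ground M \<and> (\<forall>Z. is_cyclic_flat M Z \<longrightarrow> card (I \<inter> Z) \<le> rank_on M Z)"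
proof
  assume I: "I \<in> indeps M"
  have "card (I \<inter> Z) \<le> rank_on M Z" for Z
    using I by (intro card_subset_le_rank_on[of I]) auto
  then show "I \<subseteq> ground M \<and> (\<forall>Z. is_cyclic_flat M Z \<longrightarrow> card (I \<inter> Z) \<le> rank_on M Z)"
    using I indeps_subset by auto
next
  assume I: "I \<subseteq> ground M \<and> (\<forall>Z. is_cyclic_flat M Z \<longrightarrow> card (I \<inter> Z) \<le> rank_on M Z)"
  show "I \<in> indeps M"
  proof (rule ccontr)
    assume "I \<notin> indeps M"
    then obtain C where C: "C \<in> circuits M" "C \<subseteq> I" using dependent_contains_circuit I by metis
    then have CE: "C \<subseteq> ground M" by (auto simp: circuits_def)
    have "card C \<le> card (I \<inter> cl C)"
      using C I subset_cl[OF CE] finite_subset[OF _ finite_ground, of I] by (intro card_mono) auto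
    also have "\<dots> \<le> rank_on M C" using I C is_cyclic_flat_cl_circuit rank_on_cl[OF CE] by metis
    finally show False using card_circuit[OF C(1)] by simp
  qed
qed

end

text \<open>By \<open>indep_iff_cyclic_flats\<close>, independence can be read off the cyclic flats
  and their ranks. This is the uniqueness needed to evaluate the \<open>THE\<close> in
  \<open>M_construction\<close>.\<close>

lemma matroid_eq_if_cyclic_flats_eq:
  fixes M N :: "'a set_system"
  assumes "matroid M" "matroid N" "ground M = ground N"
    and "{(Z, rank_on M Z) | Z. is_cyclic_flat M Z} = {(Z, rank_on N Z) | Z. is_cyclic_flat N Z}"
  shows "M = N"
proof -
  have 1: "is_cyclic_flat M Z \<longleftrightarrow> is_cyclic_flat N Z"
    and 2: "is_cyclic_flat M Z \<Longrightarrow> rank_on M Z = rank_on N Z" for Z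
    using assms(4) unfolding set_eq_iff by blast+
  have "I \<in> indeps M \<longleftrightarrow> I \<in> indeps N" for I
    unfolding matroid.indep_iff_cyclic_flats[OF assms(1)] matroid.indep_iff_cyclic_flats[OF assms(2)]
    using 1 2 assms(3) by auto
  then show ?thesis using assms(3) by (intro set_system.equality) auto
qed

section \<open>The dual matroid and its rank function\<close>

context matroid begin

lemma indeps_dual_matroid:
  "indeps (dual_matroid M) = {I. I \<subseteq> ground M \<and> rank_on M (ground M - I) = rank_of M}"
proof (intro set_eqI iffI)
  fix I assume "I \<in> indeps (dual_matroid M)"
  then obtain B where B: "is_basis M B" "I \<subseteq> ground M - B" by (auto simp: dual_matroid_def)
  then have "B \<in> indeps M" "card B = rank_of M" "B \<subseteq> ground M - I"
    using is_basis_iff indeps_subset[of B] by auto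
  then have "rank_of M \<le> rank_on M (ground M - I)" by (metis card_le_rank_on)
  then show "I \<in> {I. I \<subseteq> ground M \<and> rank_on M (ground M - I) = rank_of M}"
    using B rank_on_mono[of "ground M - I" "ground M"] by auto
next
  fix I assume I: "I \<in> {I. I \<subseteq> ground M \<and> rank_on M (ground M - I) = rank_of M}"
  obtain B where "B \<in> indeps M" "B \<subseteq> ground M - I" "card B = rank_on M (ground M - I)"
    by (rule rank_on_witness)
  then have "is_basis M B" "I \<subseteq> ground M - B" using I is_basis_iff by auto
  then show "I \<in> indeps (dual_matroid M)" by (auto simp: dual_matroid_def)
qed

lemma ground_dual_matroid [simp]: "ground (dual_matroid M) = ground M"
  by (simp add: dual_matroid_def)

lemma matroid_dual_matroid: "matroid (dual_matroid M)"
proof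
  fix I J assume I: "I \<in> indeps (dual_matroid M)" and J: "J \<in> indeps (dual_matroid M)"
    and less: "card I < card J"
  have IJ: "I \<subseteq> ground M" "J \<subseteq> ground M" "finite I" "finite J"
    using I J finite_ground finite_subset by (auto simp: indeps_dual_matroid)
  obtain BJ where BJ: "BJ \<in> indeps M" "BJ \<subseteq> ground M - J" "card BJ = rank_of M"
    using J rank_on_witness[of "ground M - J"] by (auto simp: indeps_dual_matroid)
  have "BJ - I \<in> indeps M" "BJ - I \<subseteq> ground M - I" using BJ(2) indep_mono[OF BJ(1)] by auto
  then obtain B where B: "B \<in> indeps M" "BJ - I \<subseteq> B" "B \<subseteq> ground M - I" "card B = rank_of M"
    using indep_extend I by (metis (mono_tags, lifting) indeps_dual_matroid mem_Collect_eq)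
  have fin: "finite B" "finite BJ" using B BJ finite_indep by auto
  \<comment> \<open>\<open>B\<close> is a basis that avoids \<open>I\<close> and contains
    \<open>BJ - I\<close>. If it contained \<open>J - I\<close> too, it would be larger than
    \<open>BJ\<close>, because \<open>BJ\<close> avoids \<open>J\<close> and \<open>I - J\<close> is
    smaller than \<open>J - I\<close>. An element of \<open>J - I\<close> outside \<open>B\<close>
    can then be added to \<open>I\<close>.\<close>
  have "\<not> J - I \<subseteq> B"
  proof
    assume sub: "J - I \<subseteq> B"
    have "card (BJ - I) + card (J - I) = card ((BJ - I) \<union> (J - I))"
      using BJ fin IJ by (intro card_Un_disjoint[symmetric]) auto
    also have "\<dots> \<le> card B" using sub B fin by (intro card_mono) auto
    finally have a: "card (BJ - I) + card (J - I) \<le> card BJ" using B BJ by simp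
    have b: "card BJ = card (BJ - I) + card (BJ \<inter> I)"
      using fin by (metis add.commute card_Int_Diff)
    have c: "card (BJ \<inter> I) \<le> card (I - J)" using BJ IJ by (intro card_mono) auto
    have d: "card I = card (I \<inter> J) + card (I - J)" "card J = card (J \<inter> I) + card (J - I)"
      using IJ by (auto simp: card_Int_Diff)
    show False using a b c d less by (simp add: Int_commute)
  qed
  then obtain x where x: "x \<in> J - I" "x \<notin> B" by auto
  then have "B \<subseteq> ground M - insert x I" using B by auto
  then have "rank_of M \<le> rank_on M (ground M - insert x I)" using B card_le_rank_on by metis
  then have "insert x I \<in> indeps (dual_matroid M)"
    using x IJ rank_on_mono[of "ground M - insert x I" "ground M"]
    by (auto simp: indeps_dual_matroid)
  then show "\<exists>x \<in> J - I. insert x I \<in> indeps (dual_matroid M)" using x by auto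
next
  fix I J assume I: "I \<in> indeps (dual_matroid M)" and J: "J \<subseteq> I"
  have "rank_on M (ground M - I) \<le> rank_on M (ground M - J)" using J by (intro rank_on_mono) auto
  then show "J \<in> indeps (dual_matroid M)"
    using I J rank_on_mono[of "ground M - J" "ground M"] by (auto simp: indeps_dual_matroid)
qed (auto simp: indeps_dual_matroid finite_ground)

text \<open>The corank formula, arranged without subtraction on naturals. Upper bound: a basis that
  avoids a maximum coindependent \<open>I\<close> in \<open>X\<close> has at most
  \<open>card (X - I)\<close> elements in \<open>X\<close>. Lower bound: a maximum independent set
  outside \<open>X\<close> extends to a basis \<open>B\<close>, and \<open>X - B\<close> is
  coindependent.\<close>

lemma rank_on_dual_matroid:
  assumes X: "X \<subseteq> ground M"
  shows "rank_on (dual_matroid M) X + rank_of M = card X + rank_on M (ground M - X)"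
proof -
  interpret D: matroid "dual_matroid M" by (rule matroid_dual_matroid)
  have finX: "finite X" using X finite_ground by (rule finite_subset)
  have "rank_on (dual_matroid M) X + rank_of M \<le> card X + rank_on M (ground M - X)"
  proof -
    obtain I where I: "I \<in> indeps (dual_matroid M)" "I \<subseteq> X" "card I = rank_on (dual_matroid M) X"
      by (rule D.rank_on_witness)
    obtain B where B: "B \<in> indeps M" "B \<subseteq> ground M - I" "card B = rank_of M"
      using I rank_on_witness[of "ground M - I"] by (auto simp: indeps_dual_matroid)
    have "card (B - X) \<le> rank_on M (ground M - X)"
      using B by (intro card_subset_le_rank_on[of B]) auto
    moreover have "card (B \<inter> X) \<le> card (X - I)" using B finX by (intro card_mono) auto
    moreover have "card B = card (B \<inter> X) + card (B - X)"
      using finite_indep[OF B(1)] by (metis card_Int_Diff)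
    moreover have "card (X - I) = card X - card I" "card I \<le> card X"
      using card_Diff_subset[OF finite_subset[OF I(2) finX] I(2)] card_mono[OF finX I(2)] by auto
    ultimately show ?thesis using B I by linarith
  qed
  moreover have "card X + rank_on M (ground M - X) \<le> rank_on (dual_matroid M) X + rank_of M"
  proof -
    obtain B' where B': "B' \<in> indeps M" "B' \<subseteq> ground M - X" "card B' = rank_on M (ground M - X)"
      by (rule rank_on_witness)
    obtain B where B: "B \<in> indeps M" "B' \<subseteq> B" "B \<subseteq> ground M" "card B = rank_of M"
      by (rule indep_extend[OF B'(1) indeps_subset[OF B'(1)]])
    have fin: "finite B" using B finite_indep by auto
    have "X - B \<in> indeps (dual_matroid M)"
      using X B is_basis_iff[of B] by (auto simp: dual_matroid_def)
    then have "card (X - B) \<le> rank_on (dual_matroid M) X"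
      by (rule D.card_le_rank_on) auto
    moreover have "card B' + card (B \<inter> X) \<le> card B"
    proof -
      have "card B' + card (B \<inter> X) = card (B' \<union> (B \<inter> X))"
        using B' fin finite_indep[OF B'(1)] by (intro card_Un_disjoint[symmetric]) auto
      also have "\<dots> \<le> card B" using B fin by (intro card_mono) auto
      finally show ?thesis .
    qed
    moreover have "card X = card (B \<inter> X) + card (X - B)"
      using finX by (metis card_Int_Diff inf_commute)
    ultimately show ?thesis using B B' by linarith
  qed
  ultimately show ?thesis by simp
qed

lemma rank_of_dual_matroid: "rank_of (dual_matroid M) + rank_of M = card (ground M)"
  using rank_on_dual_matroid[of "ground M"] rank_on_le_card[of "{}"] by simp

end

section \<open>Minors and free extensions\<close>

text \<open>For independent \<open>X\<close> this is \<open>M\<close> with \<open>X\<close>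
  contracted and \<open>Y\<close> deleted, without any mention of rank or duality. By
  \<open>minor_ofE\<close>, every minor has this form.\<close>

definition minor_by :: "'a set_system \<Rightarrow> 'a set \<Rightarrow> 'a set \<Rightarrow> 'a set_system" where
  "minor_by M X Y = \<lparr>ground = ground M - X - Y,
     indeps = {I. I \<subseteq> ground M - X - Y \<and> I \<union> X \<in> indeps M}\<rparr>"

lemma ground_minor_by [simp]: "ground (minor_by M X Y) = ground M - X - Y"
  by (simp add: minor_by_def)

lemma indeps_minor_by:
  "I \<in> indeps (minor_by M X Y) \<longleftrightarrow> I \<subseteq> ground M - X - Y \<and> I \<union> X \<in> indeps M"
  by (simp add: minor_by_def)

lemma minor_by_minor_by:
  assumes "X' \<subseteq> ground M - X - Y"
  shows "minor_by (minor_by M X Y) X' Y' = minor_by M (X \<union> X') (Y \<union> Y')"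
proof -
  have "I \<subseteq> ground M - X - Y - X' - Y' \<and> I \<union> X' \<in> indeps (minor_by M X Y) \<longleftrightarrow>
     I \<subseteq> ground M - (X \<union> X') - (Y \<union> Y') \<and> I \<union> (X \<union> X') \<in> indeps M" for I
    using assms by (auto simp: indeps_minor_by Un_ac)
  then show ?thesis
    by (subst minor_by_def, subst (2) minor_by_def) (auto simp: Diff_eq Int_ac)
qed

context matroid begin

lemma minor_by_empty: "minor_by M {} {} = M"
  by (intro set_system.equality) (auto simp: minor_by_def dest: indeps_subset)

lemma matroid_minor_by:
  assumes "X \<in> indeps M"
  shows "matroid (minor_by M X Y)"
proof
  show "finite (ground (minor_by M X Y))" using finite_ground by simp
  show "{} \<in> indeps (minor_by M X Y)" using assms by (simp add: indeps_minor_by)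
next
  fix I J assume "I \<in> indeps (minor_by M X Y)" "J \<subseteq> I"
  then show "J \<in> indeps (minor_by M X Y)"
    using indep_mono[of "I \<union> X" "J \<union> X"] by (auto simp: indeps_minor_by)
next
  fix I J assume I: "I \<in> indeps (minor_by M X Y)" and J: "J \<in> indeps (minor_by M X Y)"
    and less: "card I < card J"
  have fin: "finite (I \<union> X)" "finite (J \<union> X)"
    using finite_indep[of "I \<union> X"] finite_indep[of "J \<union> X"] I J by (simp_all add: indeps_minor_by)
  have "card (I \<union> X) = card I + card X" "card (J \<union> X) = card J + card X"
    using I J fin by (auto simp: indeps_minor_by intro!: card_Un_disjoint)
  then obtain x where "x \<in> J \<union> X - (I \<union> X)" "insert x (I \<union> X) \<in> indeps M"
    using indep_augment[of "I \<union> X" "J \<union> X"] I J less by (auto simp: indeps_minor_by)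
  then show "\<exists>x \<in> J - I. insert x I \<in> indeps (minor_by M X Y)"
    using I J by (intro bexI[of _ x]) (auto simp: indeps_minor_by)
qed (auto simp: indeps_minor_by)

lemma matroid_delete_elems: "matroid (delete_elems M X)"
proof
  fix I J assume "I \<in> indeps (delete_elems M X)" "J \<in> indeps (delete_elems M X)" "card I < card J"
  then show "\<exists>x \<in> J - I. insert x I \<in> indeps (delete_elems M X)"
    using indep_augment[of I J] by (auto simp: delete_elems_def)
next
  fix I J assume "I \<in> indeps (delete_elems M X)" "J \<subseteq> I"
  then show "J \<in> indeps (delete_elems M X)"
    using indep_mono[of I J] by (auto simp: delete_elems_def)
next
  fix I assume "I \<in> indeps (delete_elems M X)"
  then show "I \<subseteq> ground (delete_elems M X)"
    using indeps_subset[of I] by (auto simp: delete_elems_def)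
qed (auto simp: delete_elems_def finite_ground empty_indep)

lemma rank_on_delete_elems: "Z \<inter> X = {} \<Longrightarrow> rank_on (delete_elems M X) Z = rank_on M Z"
proof -
  assume "Z \<inter> X = {}"
  then have "{I \<in> indeps (delete_elems M X). I \<subseteq> Z} = {I \<in> indeps M. I \<subseteq> Z}"
    by (auto simp: delete_elems_def)
  then show ?thesis by (simp add: rank_on_def)
qed

lemma ground_contract_elems [simp]: "ground (contract_elems M X) = ground M - X"
  by (simp add: contract_elems_def delete_elems_def dual_matroid_def)

text \<open>The corank formula, used at \<open>ground M - X - I\<close> and at
  \<open>ground M - X\<close>, turns the condition on dual ranks into one on ranks in
  \<open>M\<close>.\<close>

lemma indeps_contract_elems:
  assumes X: "X \<subseteq> ground M"
  shows "indeps (contract_elems M X) =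
    {I. I \<subseteq> ground M - X \<and> rank_on M (I \<union> X) = card I + rank_on M X}"
proof -
  interpret D: matroid "dual_matroid M" by (rule matroid_dual_matroid)
  interpret C: matroid "delete_elems (dual_matroid M) X" by (rule D.matroid_delete_elems)
  have g: "ground (delete_elems (dual_matroid M) X) = ground M - X"
    by (simp add: delete_elems_def)
  have "rank_on (delete_elems (dual_matroid M) X) (ground M - X - I)
        = rank_on (delete_elems (dual_matroid M) X) (ground M - X) \<longleftrightarrow>
      rank_on M (I \<union> X) = card I + rank_on M X" if I: "I \<subseteq> ground M - X" for I
  proof -
    have e: "ground M - (ground M - X - I) = I \<union> X" "ground M - (ground M - X) = X"
      using I X by auto
    have s: "ground M - X - I \<subseteq> ground M" "ground M - X \<subseteq> ground M" by auto
    have "card (ground M - X - I) = card (ground M - X) - card I" "card I \<le> card (ground M - X)"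
      using I finite_ground finite_subset[OF I] by (auto intro!: card_Diff_subset card_mono)
    then have "rank_on (dual_matroid M) (ground M - X - I) = rank_on (dual_matroid M) (ground M - X)
      \<longleftrightarrow> rank_on M (I \<union> X) = card I + rank_on M X"
      using rank_on_dual_matroid[OF s(1), unfolded e] rank_on_dual_matroid[OF s(2), unfolded e]
      by linarith
    moreover have "(ground M - X - I) \<inter> X = {}" "(ground M - X) \<inter> X = {}" by auto
    ultimately show ?thesis by (simp add: D.rank_on_delete_elems)
  qed
  then show ?thesis
    unfolding contract_elems_def C.indeps_dual_matroid g by auto
qed

text \<open>Independence after contracting \<open>X\<close> can be tested on a single maximum
  independent subset \<open>B\<close> of \<open>X\<close>. From right to left the rank is
  subadditive. From left to right, \<open>B\<close> extends to a maximum independent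
  \<open>A\<close> in \<open>I \<union> X\<close>; \<open>A\<close> meets \<open>X\<close> in
  \<open>B\<close> only, so by counting it contains all of \<open>I\<close>.\<close>

lemma rank_on_Un_eq_iff:
  assumes B: "B \<in> indeps M" "B \<subseteq> X" "card B = rank_on M X"
    and I: "finite I" "I \<inter> X = {}"
  shows "rank_on M (I \<union> X) = card I + rank_on M X \<longleftrightarrow> I \<union> B \<in> indeps M"
proof
  have disj: "card (I \<union> B) = card I + card B"
    using B I finite_indep by (intro card_Un_disjoint) auto
  show "rank_on M (I \<union> X) = card I + rank_on M X" if IB: "I \<union> B \<in> indeps M"
  proof (rule antisym)
    show "card I + rank_on M X \<le> rank_on M (I \<union> X)"
      unfolding B(3)[symmetric] disj[symmetric] using IB B by (intro card_le_rank_on) auto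
    show "rank_on M (I \<union> X) \<le> card I + rank_on M X"
    proof (rule rank_on_le)
      fix A assume A: "A \<in> indeps M" "A \<subseteq> I \<union> X"
      have "card A \<le> card (A \<inter> I) + card (A \<inter> X)"
        using A(2) card_Un_le[of "A \<inter> I" "A \<inter> X"] by (simp add: Int_Un_distrib[symmetric] Int_absorb2)
      moreover have "card (A \<inter> I) \<le> card I" using I by (intro card_mono) auto
      moreover have "card (A \<inter> X) \<le> rank_on M X"
        using A by (intro card_subset_le_rank_on[of A]) auto
      ultimately show "card A \<le> card I + rank_on M X" by linarith
    qed
  qed
  show "I \<union> B \<in> indeps M" if r: "rank_on M (I \<union> X) = card I + rank_on M X"
  proof -
    have "B \<subseteq> I \<union> X" using B by auto
    with B(1) obtain A where A: "A \<in> indeps M" "B \<subseteq> A" "A \<subseteq> I \<union> X" "card A = rank_on M (I \<union> X)"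
      by (rule indep_extend)
    have finA: "finite A" by (rule finite_indep[OF A(1)])
    have "card (A \<inter> X) \<le> card B"
      using A B by (simp add: card_subset_le_rank_on[of A])
    then have 1: "A \<inter> X = B"
      using A(2) B(2) finA by (intro card_seteq[symmetric]) auto
    have "card A = card (A \<inter> X) + card (A - X)" using finA by (metis card_Int_Diff)
    then have "card I \<le> card (A - X)" using A r 1 B by simp
    then have "A - X = I" using A(3) I by (intro card_seteq) auto
    then have "I \<union> B = A" using 1 by auto
    then show ?thesis using A by simp
  qed
qed

text \<open>What completes one basis of \<open>Z\<close> completes every other. Extend
  \<open>A'\<close> as far as possible inside \<open>A' \<union> A \<union> K\<close>: the result
  meets \<open>Z\<close> in \<open>A'\<close> only, and its size forces it to contain all of
  \<open>K\<close>.\<close>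

lemma indep_Un_exchange:
  assumes AK: "A \<union> K \<in> indeps M" and A': "A' \<in> indeps M" "A' \<subseteq> Z"
    and card: "card A = rank_on M Z" "card A' = rank_on M Z" and sub: "A \<subseteq> Z" "K \<inter> Z = {}"
  shows "A' \<union> K \<in> indeps M"
proof -
  have fin: "finite A" "finite K" using finite_indep[OF AK] by auto
  have "A' \<subseteq> A' \<union> A \<union> K" by auto
  with A'(1) obtain G where G: "G \<in> indeps M" "A' \<subseteq> G" "G \<subseteq> A' \<union> A \<union> K"
      "card G = rank_on M (A' \<union> A \<union> K)"
    by (rule indep_extend)
  have finG: "finite G" by (rule finite_indep[OF G(1)])
  have "card (A \<union> K) \<le> card G" unfolding G(4) using AK by (intro card_le_rank_on) auto
  moreover have "card (A \<union> K) = card A + card K" using fin sub by (intro card_Un_disjoint) auto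
  ultimately have a: "card A' + card K \<le> card G" using card by simp
  have "card (G \<inter> Z) \<le> card A'"
    unfolding card(2) using G by (intro card_subset_le_rank_on[of G]) auto
  then have 1: "G \<inter> Z = A'" using finG G(2) A'(2) by (intro card_seteq[symmetric]) auto
  have "G - Z \<subseteq> K" using G(3) A'(2) sub by auto
  moreover have "card G = card (G \<inter> Z) + card (G - Z)" using finG by (metis card_Int_Diff)
  ultimately have "G - Z = K" using a 1 fin by (intro card_seteq) auto
  then have "A' \<union> K = G" using 1 by auto
  then show ?thesis using G by simp
qed

lemma minor_of_minor_by:
  assumes "X \<in> indeps M" "Y \<subseteq> ground M" "X \<inter> Y = {}"
  shows "minor_of (minor_by M X Y) M"
proof -
  have X: "X \<subseteq> ground M" by (rule indeps_subset[OF assms(1)])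
  have "I \<subseteq> ground M - X \<and> rank_on M (I \<union> X) = card I + rank_on M X \<longleftrightarrow>
      I \<subseteq> ground M - X \<and> I \<union> X \<in> indeps M" for I
    using rank_on_Un_eq_iff[of X X I] assms(1) rank_on_indep[of X] finite_subset[OF _ finite_ground, of I]
    by auto
  then have "minor_by M X Y = delete_elems (contract_elems M X) Y"
    by (intro set_system.equality)
      (auto simp: minor_by_def delete_elems_def indeps_contract_elems[OF X])
  then show ?thesis unfolding minor_of_def using X assms by blast
qed

text \<open>A normal form for minors: the contracted set is independent and deletion loses no rank.
  Of \<open>X\<close>, only a maximum independent subset \<open>B\<close> is contracted and the rest
  is deleted; of \<open>Y\<close>, as much is contracted as a basis of \<open>M\<close> needs beyond
  \<open>X\<close> and the remaining elements \<open>P\<close>.\<close>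

lemma minor_ofE:
  assumes "minor_of N M"
  obtains X Y where "X \<in> indeps M" "Y \<subseteq> ground M" "X \<inter> Y = {}" "N = minor_by M X Y"
    "rank_of N + card X = rank_of M"
proof -
  obtain X Y where XY: "X \<subseteq> ground M" "Y \<subseteq> ground M" "X \<inter> Y = {}"
    and N: "N = delete_elems (contract_elems M X) Y"
    using assms unfolding minor_of_def by blast
  define P where "P = ground M - X - Y"
  obtain B where B: "B \<in> indeps M" "B \<subseteq> X" "card B = rank_on M X" by (rule rank_on_witness)
  have "B \<subseteq> X \<union> P" using B by auto
  with B(1) obtain A where A: "A \<in> indeps M" "B \<subseteq> A" "A \<subseteq> X \<union> P" "card A = rank_on M (X \<union> P)"
    by (rule indep_extend)
  obtain G where G: "G \<in> indeps M" "A \<subseteq> G" "G \<subseteq> ground M" "card G = rank_of M"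
    by (rule indep_extend[OF A(1) indeps_subset[OF A(1)]])
  have fin: "finite G" "finite A" using finite_indep G A by auto
  have AX: "A \<inter> X = B"
    using A(2) B(2) fin card_subset_le_rank_on[OF A(1), of "A \<inter> X" X] B(3)
    by (intro card_seteq[symmetric]) auto
  have GA: "G \<inter> (X \<union> P) = A"
    using G(2) A(3,4) fin card_subset_le_rank_on[OF G(1), of "G \<inter> (X \<union> P)" "X \<union> P"]
    by (intro card_seteq[symmetric]) auto
  \<comment> \<open>\<open>G - A\<close> is the part of the basis \<open>G\<close> outside
    \<open>X \<union> P\<close>. By \<open>indep_Un_exchange\<close> it can be added to any
    independent subset of \<open>X \<union> P\<close> that contains \<open>B\<close>, once that is
    extended to a maximum one, so contracting it gives the same minor as deleting it.\<close>
  define X' where "X' = B \<union> (G - A)"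
  define Y' where "Y' = ground M - P - X'"
  have X'ind: "X' \<in> indeps M" using indep_mono[OF G(1), of X'] A G by (auto simp: X'_def)
  have sub: "X' \<subseteq> X \<union> Y" using B G GA by (auto simp: X'_def P_def)
  have P: "ground M - X' - Y' = P" using sub by (auto simp: Y'_def P_def)
  have iff: "rank_on M (I \<union> X) = card I + rank_on M X \<longleftrightarrow> I \<union> X' \<in> indeps M" if I: "I \<subseteq> P" for I
  proof -
    have finI: "finite I" using I finite_subset[OF _ finite_ground, of I] by (auto simp: P_def)
    have "rank_on M (I \<union> X) = card I + rank_on M X \<longleftrightarrow> I \<union> B \<in> indeps M"
      using I B finI by (intro rank_on_Un_eq_iff) (auto simp: P_def)
    also have "\<dots> \<longleftrightarrow> I \<union> X' \<in> indeps M"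
    proof
      assume "I \<union> X' \<in> indeps M"
      then show "I \<union> B \<in> indeps M" by (rule indep_mono) (auto simp: X'_def)
    next
      assume IB: "I \<union> B \<in> indeps M"
      have "I \<union> B \<subseteq> X \<union> P" using I B by auto
      with IB obtain A' where A': "A' \<in> indeps M" "I \<union> B \<subseteq> A'" "A' \<subseteq> X \<union> P"
          "card A' = rank_on M (X \<union> P)"
        by (rule indep_extend)
      have "A \<union> (G - A) \<in> indeps M" using G by (simp add: Un_absorb1)
      then have "A' \<union> (G - A) \<in> indeps M"
        using GA by (intro indep_Un_exchange[OF _ A'(1,3) A(4) A'(4) A(3)]) auto
      then show "I \<union> X' \<in> indeps M" by (rule indep_mono) (use A' in \<open>auto simp: X'_def\<close>)
    qed
    finally show ?thesis .
  qed
  have NM: "N = minor_by M X' Y'"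
  proof (rule set_system.equality)
    show "ground N = ground (minor_by M X' Y')"
      using P by (simp add: N delete_elems_def P_def)
    have "I \<in> indeps N \<longleftrightarrow> I \<in> indeps (minor_by M X' Y')" for I
    proof -
      have "I \<in> indeps N \<longleftrightarrow> I \<subseteq> P \<and> rank_on M (I \<union> X) = card I + rank_on M X"
        unfolding N delete_elems_def P_def using indeps_contract_elems[OF XY(1)] by auto
      also have "\<dots> \<longleftrightarrow> I \<subseteq> P \<and> I \<union> X' \<in> indeps M" using iff by auto
      finally show ?thesis by (simp add: indeps_minor_by P)
    qed
    then show "indeps N = indeps (minor_by M X' Y')" by blast
  qed simp
  interpret N: matroid N unfolding NM by (rule matroid_minor_by[OF X'ind])
  have "rank_of N + card X' = rank_of M"
  proof (rule antisym)
    obtain I where I: "I \<in> indeps N" "card I = rank_of N" by (rule N.rank_on_witness)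
    have IX: "I \<union> X' \<in> indeps M" "I \<inter> X' = {}" using I by (auto simp: NM indeps_minor_by)
    have "card I + card X' = card (I \<union> X')"
      using IX finite_indep[OF IX(1)] by (intro card_Un_disjoint[symmetric]) auto
    also have "\<dots> \<le> rank_of M" using IX indeps_subset by (intro card_le_rank_on) auto
    finally show "rank_of N + card X' \<le> rank_of M" using I by simp
  next
    have eq: "(A - B) \<union> X' = G" using A G by (auto simp: X'_def)
    have "A - B \<subseteq> P" using A(3) AX by auto
    then have "A - B \<in> indeps N" using eq G by (simp add: NM indeps_minor_by P)
    then have "card (A - B) \<le> rank_of N" using N.indeps_subset by (intro N.card_le_rank_on) auto
    moreover have "card G \<le> card (A - B) + card X'"
      unfolding eq[symmetric] by (rule card_Un_le)
    ultimately show "rank_of M \<le> rank_of N + card X'" using G by simp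
  qed
  then show ?thesis
    by (intro that[of X' Y'] X'ind NM) (auto simp: Y'_def)
qed

section \<open>Free extension and free coextension by one element\<close>

lemma indeps_free_ext:
  assumes x: "x \<notin> ground M"
  shows "I \<in> indeps (free_ext M x) \<longleftrightarrow>
    I - {x} \<in> indeps M \<and> (x \<in> I \<longrightarrow> card (I - {x}) < rank_of M)"
proof -
  have "(\<not> (\<exists>C \<in> circuits M. C \<subseteq> I)) \<longleftrightarrow> I - {x} \<in> indeps M" if I: "I \<subseteq> insert x (ground M)"
  proof
    assume n: "\<not> (\<exists>C \<in> circuits M. C \<subseteq> I)"
    show "I - {x} \<in> indeps M"
    proof (rule ccontr)
      assume "I - {x} \<notin> indeps M"
      moreover have "I - {x} \<subseteq> ground M" using I by auto
      ultimately obtain C where "C \<in> circuits M" "C \<subseteq> I - {x}"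
        by (metis dependent_contains_circuit)
      then show False using n by auto
    qed
  next
    assume Ix: "I - {x} \<in> indeps M"
    show "\<not> (\<exists>C \<in> circuits M. C \<subseteq> I)"
    proof clarify
      fix C assume C: "C \<in> circuits M" "C \<subseteq> I"
      then have "C \<subseteq> I - {x}" using circuit_subset_ground[of C] x by auto
      then have "C \<in> indeps M" by (rule indep_mono[OF Ix])
      then show False using C by (simp add: circuits_def)
    qed
  qed
  moreover have "(\<exists>B. is_basis M B \<and> insert x B \<subseteq> I) \<longleftrightarrow> x \<in> I \<and> \<not> card (I - {x}) < rank_of M"
    if I: "I - {x} \<in> indeps M"
  proof
    assume "\<exists>B. is_basis M B \<and> insert x B \<subseteq> I"
    then obtain B where B: "B \<in> indeps M" "card B = rank_of M" "insert x B \<subseteq> I"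
      by (auto simp: is_basis_iff)
    then have "B \<subseteq> I - {x}" using x indeps_subset[of B] by auto
    then have "card B \<le> card (I - {x})" by (intro card_mono finite_indep[OF I])
    then show "x \<in> I \<and> \<not> card (I - {x}) < rank_of M" using B by auto
  next
    assume *: "x \<in> I \<and> \<not> card (I - {x}) < rank_of M"
    then have "card (I - {x}) = rank_of M"
      using card_le_rank_on[OF I indeps_subset[OF I]] by simp
    then have "is_basis M (I - {x})" using I by (simp add: is_basis_iff)
    then show "\<exists>B. is_basis M B \<and> insert x B \<subseteq> I" using * by (intro exI[of _ "I - {x}"]) auto
  qed
  moreover have "I \<subseteq> insert x (ground M)" if "I - {x} \<in> indeps M"
    using indeps_subset[OF that] by auto
  moreover have "I \<in> indeps (free_ext M x) \<longleftrightarrow> I \<subseteq> insert x (ground M) \<and>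
      \<not> (\<exists>C \<in> circuits M. C \<subseteq> I) \<and> \<not> (\<exists>B. is_basis M B \<and> insert x B \<subseteq> I)"
    unfolding free_ext_def matroid_of_circuits_def set_system.simps mem_Collect_eq by blast
  ultimately show ?thesis by blast
qed

lemma ground_free_ext [simp]: "ground (free_ext M x) = insert x (ground M)"
  by (simp add: free_ext_def matroid_of_circuits_def)

lemma matroid_free_ext:
  assumes x: "x \<notin> ground M"
  shows "matroid (free_ext M x)"
proof
  fix I assume "I \<in> indeps (free_ext M x)"
  then show "I \<subseteq> ground (free_ext M x)" using indeps_subset[of "I - {x}"]
    by (auto simp: indeps_free_ext[OF x])
next
  fix I J assume IJ: "I \<in> indeps (free_ext M x)" "J \<subseteq> I"
  then have I: "I - {x} \<in> indeps M" by (simp add: indeps_free_ext[OF x])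
  have "J - {x} \<subseteq> I - {x}" using IJ by auto
  then have "J - {x} \<in> indeps M" "card (J - {x}) \<le> card (I - {x})"
    using indep_mono[OF I] card_mono[OF finite_indep[OF I]] by auto
  then show "J \<in> indeps (free_ext M x)" using IJ by (auto simp: indeps_free_ext[OF x])
next
  fix I J assume I: "I \<in> indeps (free_ext M x)" and J: "J \<in> indeps (free_ext M x)"
    and less: "card I < card J"
  have I': "I - {x} \<in> indeps M" and J': "J - {x} \<in> indeps M"
    using I J by (simp_all add: indeps_free_ext[OF x])
  have fin: "finite I" "finite J" using finite_indep[OF I'] finite_indep[OF J'] by simp_all
  define i j where "i = card (I - {x})" and "j = card (J - {x})"
  have cI: "card I = (if x \<in> I then Suc i else i)" and cJ: "card J = (if x \<in> J then Suc j else j)"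
    unfolding i_def j_def
    using card_Suc_Diff1[OF fin(1), of x] card_Suc_Diff1[OF fin(2), of x]
    by (simp_all del: card_Diff_insert)
  have jr: "j \<le> rank_of M" and jr': "x \<in> J \<Longrightarrow> j < rank_of M"
    unfolding j_def
    using card_le_rank_on[OF J' indeps_subset[OF J']] J by (simp_all only: indeps_free_ext[OF x] simp_thms)
  have rJ: "card J \<le> rank_of M" using cJ jr jr' by (auto split: if_splits)
  show "\<exists>y \<in> J - I. insert y I \<in> indeps (free_ext M x)"
  \<comment> \<open>If \<open>i < j\<close>, augmentation in \<open>M\<close> finds an element other
    than \<open>x\<close>. Otherwise \<open>J\<close> is larger on account of \<open>x\<close>
    alone, and \<open>x\<close> can be added because \<open>i\<close> is still below the
    rank.\<close>
  proof (cases "i < j")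
    case True
    then obtain y where y: "y \<in> (J - {x}) - (I - {x})" "insert y (I - {x}) \<in> indeps M"
      using indep_augment[OF I' J'] unfolding i_def j_def by blast
    have eq: "insert y I - {x} = insert y (I - {x})" using y by auto
    have "card (insert y (I - {x})) = Suc i"
      unfolding i_def using y fin by (subst card_insert_disjoint) auto
    then have "insert y I \<in> indeps (free_ext M x)"
      unfolding indeps_free_ext[OF x] eq using y cI less rJ by auto
    then show ?thesis using y by auto
  next
    case False
    then have xs: "x \<in> J" "x \<notin> I" "i < rank_of M"
      using less cI cJ rJ by (auto split: if_splits)
    moreover have "insert x I - {x} = I - {x}" by auto
    ultimately have "insert x I \<in> indeps (free_ext M x)"
      using I' unfolding indeps_free_ext[OF x] i_def by simp
    then show ?thesis using xs by auto
  qed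
qed (auto simp: indeps_free_ext[OF x] finite_ground empty_indep)

lemma rank_on_free_ext:
  assumes x: "x \<notin> ground M" and X: "X \<subseteq> insert x (ground M)"
  shows "rank_on (free_ext M x) X =
    (if x \<in> X then min (Suc (rank_on M (X - {x}))) (rank_of M) else rank_on M X)"
proof (cases "x \<in> X")
  case False
  interpret F: matroid "free_ext M x" by (rule matroid_free_ext[OF x])
  have "{I \<in> indeps (free_ext M x). I \<subseteq> X} = {I \<in> indeps M. I \<subseteq> X}"
    using False by (force simp: indeps_free_ext[OF x])
  then show ?thesis using False by (simp add: rank_on_def)
next
  case True
  interpret F: matroid "free_ext M x" by (rule matroid_free_ext[OF x])
  have "rank_on (free_ext M x) X \<le> min (Suc (rank_on M (X - {x}))) (rank_of M)"
  proof (rule F.rank_on_le)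
    fix I assume "I \<in> indeps (free_ext M x)" "I \<subseteq> X"
    then have I: "I - {x} \<in> indeps M" "x \<in> I \<longrightarrow> card (I - {x}) < rank_of M" "I - {x} \<subseteq> X - {x}"
      by (auto simp: indeps_free_ext[OF x])
    define i where "i = card (I - {x})"
    have "i \<le> rank_on M (X - {x})" "i \<le> rank_of M" "x \<in> I \<Longrightarrow> i < rank_of M"
      unfolding i_def
      using card_le_rank_on[OF I(1,3)] card_le_rank_on[OF I(1) indeps_subset[OF I(1)]] I(2) by blast+
    moreover have "card I = (if x \<in> I then Suc i else i)"
      unfolding i_def using finite_indep[OF I(1)] card_Suc_Diff1[of I x] by (simp del: card_Diff_insert)
    ultimately show "card I \<le> min (Suc (rank_on M (X - {x}))) (rank_of M)" by auto
  qed
  moreover have "min (Suc (rank_on M (X - {x}))) (rank_of M) \<le> rank_on (free_ext M x) X"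
  proof -
    obtain B where B: "B \<in> indeps M" "B \<subseteq> X - {x}" "card B = rank_on M (X - {x})"
      by (rule rank_on_witness)
    have xB: "x \<notin> B" using B by auto
    show ?thesis
    proof (cases "card B < rank_of M")
      case True
      then have "insert x B \<in> indeps (free_ext M x)" using B xB by (simp add: indeps_free_ext[OF x])
      then have "card (insert x B) \<le> rank_on (free_ext M x) X"
        using B \<open>x \<in> X\<close> by (intro F.card_le_rank_on) auto
      then show ?thesis using B xB finite_indep[OF B(1)] by simp
    next
      case False
      have "B \<in> indeps (free_ext M x)" using B xB by (simp add: indeps_free_ext[OF x])
      then have "card B \<le> rank_on (free_ext M x) X"
        using B by (intro F.card_le_rank_on) auto
      then show ?thesis using False by simp
    qed
  qed
  ultimately show ?thesis using True by (simp only: if_True)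
qed

lemma ground_free_coext [simp]: "ground (free_coext M x) = insert x (ground M)"
  by (simp add: free_coext_def free_ext_def matroid_of_circuits_def dual_matroid_def)

lemma matroid_free_coext:
  assumes x: "x \<notin> ground M"
  shows "matroid (free_coext M x)"
proof -
  interpret D: matroid "dual_matroid M" by (rule matroid_dual_matroid)
  interpret F: matroid "free_ext (dual_matroid M) x" using x by (intro D.matroid_free_ext) simp
  show ?thesis unfolding free_coext_def by (rule F.matroid_dual_matroid)
qed

text \<open>A translation through dual ranks. The free coextension grants one unit of nullity: a set
  containing \<open>x\<close> has spent it on \<open>x\<close>, any other set may spend it inside
  \<open>M\<close>.\<close>

lemma indeps_free_coext:
  assumes x: "x \<notin> ground M"
  shows "I \<in> indeps (free_coext M x) \<longleftrightarrow> I \<subseteq> insert x (ground M) \<and>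
    (if x \<in> I then I - {x} \<in> indeps M else card I \<le> Suc (rank_on M I))"
proof -
  interpret D: matroid "dual_matroid M" by (rule matroid_dual_matroid)
  have xD: "x \<notin> ground (dual_matroid M)" using x by simp
  interpret F: matroid "free_ext (dual_matroid M) x" by (rule D.matroid_free_ext[OF xD])
  let ?E = "ground M" and ?D = "dual_matroid M"
  have full: "rank_on (free_ext ?D x) (insert x ?E) = rank_of ?D"
  proof -
    have "insert x ?E - {x} = ?E" using x by auto
    then show ?thesis using D.rank_on_free_ext[OF xD, of "insert x ?E"] by simp
  qed
  have mem: "I \<in> indeps (free_coext M x) \<longleftrightarrow>
    I \<subseteq> insert x ?E \<and> rank_on (free_ext ?D x) (insert x ?E - I) = rank_of ?D"
    unfolding free_coext_def F.indeps_dual_matroid D.ground_free_ext ground_dual_matroid full by simp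
  have main: "rank_on (free_ext ?D x) (insert x ?E - I) = rank_of ?D \<longleftrightarrow>
     (if x \<in> I then I - {x} \<in> indeps M else card I \<le> Suc (rank_on M I))" if I: "I \<subseteq> insert x ?E"
  proof (cases "x \<in> I")
    case True
    then have eq: "insert x ?E - I = ?E - (I - {x})" using x by auto
    have "x \<notin> insert x ?E - I" using True by simp
    then have "rank_on (free_ext ?D x) (insert x ?E - I) = rank_on ?D (?E - (I - {x}))"
      using D.rank_on_free_ext[OF xD, of "insert x ?E - I"] eq by auto
    moreover have IE: "I - {x} \<subseteq> ?E" using I by auto
    moreover have "?E - (?E - (I - {x})) = I - {x}" using IE by auto
    moreover have "card (?E - (I - {x})) = card ?E - card (I - {x})" "card (I - {x}) \<le> card ?E"
      using IE finite_ground finite_subset[OF IE] by (auto intro!: card_Diff_subset card_mono)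
    ultimately have "rank_on (free_ext ?D x) (insert x ?E - I) = rank_of ?D \<longleftrightarrow>
        rank_on M (I - {x}) = card (I - {x})"
      using rank_on_dual_matroid[of "?E - (I - {x})"] rank_of_dual_matroid by auto
    also have "\<dots> \<longleftrightarrow> I - {x} \<in> indeps M"
      using indep_iff_rank_on[OF IE] rank_on_le_card[OF finite_subset[OF IE finite_ground]] by auto
    finally show ?thesis using True by simp
  next
    case False
    then have IE: "I \<subseteq> ?E" using I by auto
    have eq: "insert x ?E - I - {x} = ?E - I" using x by auto
    have "x \<in> insert x ?E - I" using False by simp
    then have "rank_on (free_ext ?D x) (insert x ?E - I) = min (Suc (rank_on ?D (?E - I))) (rank_of ?D)"
      using D.rank_on_free_ext[OF xD, of "insert x ?E - I"] eq by auto
    moreover have "?E - (?E - I) = I" using IE by auto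
    moreover have "card (?E - I) = card ?E - card I" "card I \<le> card ?E"
      using IE finite_ground finite_subset[OF IE] by (auto intro!: card_Diff_subset card_mono)
    ultimately have "rank_on (free_ext ?D x) (insert x ?E - I) = rank_of ?D \<longleftrightarrow>
        card I \<le> Suc (rank_on M I)"
      using rank_on_dual_matroid[of "?E - I"] rank_of_dual_matroid by auto
    then show ?thesis using False by simp
  qed
  then show ?thesis using mem by auto
qed

end

section \<open>Iterated free coextensions and extensions\<close>

text \<open>Coextending freely by \<open>U\<close> allows nullity in \<open>N\<close> up to the number of unused elements of \<open>U\<close>;
  extending freely by \<open>W\<close> then adds only the bound on the cardinality.\<close>

definition expansion :: "'a set_system \<Rightarrow> 'a set \<Rightarrow> 'a set \<Rightarrow> 'a set_system" where
  "expansion N U W = \<lparr>ground = ground N \<union> U \<union> W,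
     indeps = {I. I \<subseteq> ground N \<union> U \<union> W \<and> card I \<le> rank_of N + card U \<and>
       card (I \<inter> (ground N \<union> U)) \<le> rank_on N (I \<inter> ground N) + card U}\<rparr>"

lemma ground_expansion [simp]: "ground (expansion N U W) = ground N \<union> U \<union> W"
  by (simp add: expansion_def)

lemma indeps_expansion:
  "I \<in> indeps (expansion N U W) \<longleftrightarrow> I \<subseteq> ground N \<union> U \<union> W \<and> card I \<le> rank_of N + card U \<and>
     card (I \<inter> (ground N \<union> U)) \<le> rank_on N (I \<inter> ground N) + card U"
  by (simp add: expansion_def)

context matroid begin

lemma expansion_empty: "expansion M {} {} = M"
proof (rule set_system.equality)
  have "I \<in> indeps (expansion M {} {}) \<longleftrightarrow> I \<in> indeps M" for I
  proof (cases "I \<subseteq> ground M")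
    case True
    then have "I \<inter> ground M = I" by auto
    then show ?thesis using True indep_iff_rank_on[OF True] rank_on_mono[OF True]
      by (auto simp: indeps_expansion)
  next
    case False
    then show ?thesis using indeps_subset[of I] by (auto simp: indeps_expansion)
  qed
  then show "indeps (expansion M {} {}) = indeps M" by blast
qed simp_all

lemma indeps_expansion_coext:
  "I \<in> indeps (expansion M U {}) \<longleftrightarrow>
    I \<subseteq> ground M \<union> U \<and> card I \<le> rank_on M (I \<inter> ground M) + card U"
proof -
  have "rank_on M (I \<inter> ground M) \<le> rank_of M" by (rule rank_on_mono) auto
  moreover have "I \<inter> (ground M \<union> U) = I" if "I \<subseteq> ground M \<union> U" using that by auto
  ultimately show ?thesis by (auto simp: indeps_expansion)
qed

text \<open>Prepares the next free coextension, whose independence test uses rank. A maximum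
  independent subset of \<open>X \<inter> ground M\<close> may be padded with arbitrary elements of
  \<open>X\<close> until size or the nullity allowance runs out.\<close>

lemma rank_on_expansion_coext:
  assumes m: "matroid (expansion M U {})" and U: "finite U" and X: "X \<subseteq> ground M \<union> U"
  shows "rank_on (expansion M U {}) X = min (card X) (rank_on M (X \<inter> ground M) + card U)"
proof -
  interpret P: matroid "expansion M U {}" by (rule m)
  have finX: "finite X" using X U finite_ground finite_subset[of X "ground M \<union> U"] by auto
  have "rank_on (expansion M U {}) X \<le> min (card X) (rank_on M (X \<inter> ground M) + card U)"
  proof (rule P.rank_on_le)
    fix I assume I: "I \<in> indeps (expansion M U {})" "I \<subseteq> X"
    have "rank_on M (I \<inter> ground M) \<le> rank_on M (X \<inter> ground M)" using I by (intro rank_on_mono) auto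
    moreover have "card I \<le> card X" using finX I by (intro card_mono)
    ultimately show "card I \<le> min (card X) (rank_on M (X \<inter> ground M) + card U)"
      using I by (simp add: indeps_expansion_coext)
  qed
  moreover have "min (card X) (rank_on M (X \<inter> ground M) + card U) \<le> rank_on (expansion M U {}) X"
  proof -
    let ?n = "min (card X) (rank_on M (X \<inter> ground M) + card U)"
    obtain B where B: "B \<in> indeps M" "B \<subseteq> X \<inter> ground M" "card B = rank_on M (X \<inter> ground M)"
      by (rule rank_on_witness)
    have "B \<subseteq> X" using B by auto
    moreover have "card B \<le> card X" using finX \<open>B \<subseteq> X\<close> by (rule card_mono)
    ultimately have "B \<subseteq> X" "card B \<le> ?n" "?n \<le> card X" using B by auto
    then obtain I where I: "B \<subseteq> I" "I \<subseteq> X" "card I = ?n"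
      using exists_subset_between[of B ?n X] finX by blast
    have "card B \<le> rank_on M (I \<inter> ground M)" using B I by (intro card_le_rank_on) auto
    then have "I \<in> indeps (expansion M U {})"
      using I X B by (auto simp: indeps_expansion_coext)
    then have "card I \<le> rank_on (expansion M U {}) X" using I by (intro P.card_le_rank_on)
    then show ?thesis using I by simp
  qed
  ultimately show ?thesis by (rule antisym)
qed

lemma expansion_insert_coext:
  assumes m: "matroid (expansion M U {})" and U: "finite U" and u: "u \<notin> ground M \<union> U"
  shows "free_coext (expansion M U {}) u = expansion M (insert u U) {}"
proof (rule set_system.equality)
  interpret P: matroid "expansion M U {}" by (rule m)
  have uP: "u \<notin> ground (expansion M U {})" using u by simp
  show "ground (free_coext (expansion M U {}) u) = ground (expansion M (insert u U) {})" by simp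
  have "I \<in> indeps (free_coext (expansion M U {}) u) \<longleftrightarrow> I \<in> indeps (expansion M (insert u U) {})" for I
  proof (cases "I \<subseteq> insert u (ground M \<union> U)")
    case sub: True
    have finI: "finite I" using sub U finite_ground finite_subset[of I "insert u (ground M \<union> U)"] by auto
    have cu: "card (insert u U) = Suc (card U)" using u U by simp
    show ?thesis
    proof (cases "u \<in> I")
      case True
      have eq: "(I - {u}) \<inter> ground M = I \<inter> ground M" using u by auto
      have "card I = Suc (card (I - {u}))" using finI True by (rule card.remove)
      moreover have "I - {u} \<subseteq> ground M \<union> U" using sub by auto
      ultimately show ?thesis
        using True sub cu unfolding P.indeps_free_coext[OF uP]
        unfolding indeps_expansion_coext eq by (simp del: card_Diff_insert)
    next
      case False
      then have "I \<subseteq> ground M \<union> U" using sub by auto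
      then show ?thesis using False sub cu unfolding P.indeps_free_coext[OF uP]
        by (auto simp: rank_on_expansion_coext[OF m U] indeps_expansion_coext)
    qed
  next
    case False
    then show ?thesis by (simp add: P.indeps_free_coext[OF uP] indeps_expansion_coext)
  qed
  then show "indeps (free_coext (expansion M U {}) u) = indeps (expansion M (insert u U) {})" by blast
qed simp

lemma expansion_coext_obtainable:
  assumes "finite U" "U \<inter> ground M = {}"
  shows "matroid (expansion M U {}) \<and> obtainable_from M (expansion M U {})"
  using assms
proof (induction U)
  case empty
  then show ?case using matroid_axioms by (simp add: expansion_empty obtainable_from.start)
next
  case (insert u U)
  then have u: "u \<notin> ground M \<union> U" and IH: "matroid (expansion M U {})" "obtainable_from M (expansion M U {})"
    by auto
  interpret P: matroid "expansion M U {}" by (rule IH)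
  have "matroid (free_coext (expansion M U {}) u)" using u by (intro P.matroid_free_coext) simp
  moreover have "obtainable_from M (free_coext (expansion M U {}) u)"
    using u IH by (intro obtainable_from.coext) simp_all
  ultimately show ?case by (simp add: expansion_insert_coext[OF IH(1) insert(1) u])
qed

lemma rank_of_expansion:
  assumes m: "matroid (expansion M U W)" and U: "finite U" "U \<inter> ground M = {}"
  shows "rank_of (expansion M U W) = rank_of M + card U"
proof (rule antisym)
  interpret P: matroid "expansion M U W" by (rule m)
  show "rank_of (expansion M U W) \<le> rank_of M + card U"
    by (rule P.rank_on_le) (simp add: indeps_expansion)
  obtain B where B: "B \<in> indeps M" "B \<subseteq> ground M" "card B = rank_of M"
    by (rule rank_on_witness)
  have c: "card (B \<union> U) = card B + card U"
    using B U finite_indep[OF B(1)] by (intro card_Un_disjoint) auto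
  have e: "(B \<union> U) \<inter> ground M = B" "(B \<union> U) \<inter> (ground M \<union> U) = B \<union> U" using B U by auto
  have "B \<union> U \<in> indeps (expansion M U W)"
    unfolding indeps_expansion e c using B rank_on_indep[OF B(1)] by auto
  then have "card (B \<union> U) \<le> rank_of (expansion M U W)" using B by (intro P.card_le_rank_on) auto
  then show "rank_of M + card U \<le> rank_of (expansion M U W)" using c B by simp
qed

text \<open>The bound on \<open>card I\<close> is the rank of the expansion, and it is the only
  constraint that a free element has to obey.\<close>

lemma expansion_insert_ext:
  assumes m: "matroid (expansion M U W)" and U: "finite U" "U \<inter> ground M = {}"
    and w: "w \<notin> ground M \<union> U \<union> W"
  shows "free_ext (expansion M U W) w = expansion M U (insert w W)"
proof (rule set_system.equality)
  interpret P: matroid "expansion M U W" by (rule m)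
  have wP: "w \<notin> ground (expansion M U W)" using w by simp
  show "ground (free_ext (expansion M U W) w) = ground (expansion M U (insert w W))" by simp
  have "I \<in> indeps (free_ext (expansion M U W) w) \<longleftrightarrow> I \<in> indeps (expansion M U (insert w W))" for I
  proof (cases "I \<subseteq> insert w (ground M \<union> U \<union> W)")
    case sub: True
    then have sub': "I - {w} \<subseteq> ground M \<union> U \<union> W" by auto
    have finW: "finite W" using P.finite_ground by simp
    have e: "(I - {w}) \<inter> (ground M \<union> U) = I \<inter> (ground M \<union> U)" "(I - {w}) \<inter> ground M = I \<inter> ground M"
      using w by auto
    have "finite I" using sub finW U finite_ground
        finite_subset[of I "insert w (ground M \<union> U \<union> W)"] by auto
    then have "w \<in> I \<Longrightarrow> card I = Suc (card (I - {w}))" by (rule card.remove)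
    then show ?thesis
      using sub sub' unfolding P.indeps_free_ext[OF wP] rank_of_expansion[OF m U]
      unfolding indeps_expansion e by (cases "w \<in> I") (auto simp del: card_Diff_insert)
  next
    case False
    then show ?thesis by (auto simp: P.indeps_free_ext[OF wP] indeps_expansion)
  qed
  then show "indeps (free_ext (expansion M U W) w) = indeps (expansion M U (insert w W))" by blast
qed simp

text \<open>All coextensions come before all extensions, so that elements of \<open>W\<close> stay
  out of the nullity bound. The result gives the matroid axioms for the expansion and puts its
  minors under the hypothesis on obtainable matroids.\<close>

lemma expansion_obtainable:
  assumes U: "finite U" "U \<inter> ground M = {}" and W: "finite W" "W \<inter> (ground M \<union> U) = {}"
  shows "matroid (expansion M U W)" "obtainable_from M (expansion M U W)"
proof -
  from W have "matroid (expansion M U W) \<and> obtainable_from M (expansion M U W)"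
  proof (induction W)
    case empty
    then show ?case using expansion_coext_obtainable[OF U] by simp
  next
    case (insert w W)
    then have w: "w \<notin> ground M \<union> U \<union> W"
      and IH: "matroid (expansion M U W)" "obtainable_from M (expansion M U W)"
      by auto
    interpret P: matroid "expansion M U W" by (rule IH)
    have "matroid (free_ext (expansion M U W) w)" using w by (intro P.matroid_free_ext) simp
    moreover have "obtainable_from M (free_ext (expansion M U W) w)"
      using w IH by (intro obtainable_from.ext) simp_all
    ultimately show ?case by (simp add: expansion_insert_ext[OF IH(1) U w])
  qed
  then show "matroid (expansion M U W)" "obtainable_from M (expansion M U W)" by simp_all
qed

end

section \<open>Isomorphic minors and rigidity\<close>

lemma matroid_isoE:
  assumes "matroid_iso M N"
  obtains f where "bij_betw f (ground M) (ground N)"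
    "\<And>X. X \<subseteq> ground M \<Longrightarrow> X \<in> indeps M \<longleftrightarrow> f ` X \<in> indeps N"
  using assms unfolding matroid_iso_def by blast

lemma matroid_iso_refl: "matroid_iso M M"
  unfolding matroid_iso_def by (intro exI[of _ id]) auto

lemma matroid_iso_bij_indeps:
  assumes M: "matroid M" and N: "matroid N" and f: "bij_betw f (ground M) (ground N)"
    and ind: "\<And>X. X \<subseteq> ground M \<Longrightarrow> X \<in> indeps M \<longleftrightarrow> f ` X \<in> indeps N"
  shows "bij_betw (image f) (indeps M) (indeps N)"
  unfolding bij_betw_def
proof
  have inj: "inj_on f (ground M)" using f by (simp add: bij_betw_def)
  show "inj_on (image f) (indeps M)"
    by (rule inj_on_subset[OF inj_on_image_Pow[OF inj]]) (auto dest: matroid.indeps_subset[OF M])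
  show "image f ` indeps M = indeps N"
  proof
    show "image f ` indeps M \<subseteq> indeps N" using ind matroid.indeps_subset[OF M] by blast
    show "indeps N \<subseteq> image f ` indeps M"
    proof
      fix J assume J: "J \<in> indeps N"
      then have "J \<subseteq> f ` ground M" using f matroid.indeps_subset[OF N] by (auto simp: bij_betw_def)
      then obtain I where "I \<subseteq> ground M" "J = f ` I" by (auto simp: subset_image_iff)
      then show "J \<in> image f ` indeps M" using ind J by blast
    qed
  qed
qed

text \<open>Rules out an isomorphism between two matroids when the independent sets of one strictly
  include those of the other.\<close>

lemma matroid_iso_card_indeps:
  assumes "matroid M" "matroid N" "matroid_iso M N"
  shows "card (indeps M) = card (indeps N)"
proof -
  obtain f where "bij_betw f (ground M) (ground N)"
    and "\<And>X. X \<subseteq> ground M \<Longrightarrow> X \<in> indeps M \<longleftrightarrow> f ` X \<in> indeps N"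
    using matroid_isoE[OF assms(3)] by blast
  then show ?thesis using matroid_iso_bij_indeps[OF assms(1,2)] bij_betw_same_card by blast
qed

lemma matroid_iso_card_ground: "matroid_iso M N \<Longrightarrow> card (ground M) = card (ground N)"
  unfolding matroid_iso_def using bij_betw_same_card by blast

lemma matroid_iso_rank_of:
  assumes M: "matroid M" and N: "matroid N" and iso: "matroid_iso M N"
  shows "rank_of M = rank_of N"
proof -
  obtain f where f: "bij_betw f (ground M) (ground N)"
    and ind: "\<And>X. X \<subseteq> ground M \<Longrightarrow> X \<in> indeps M \<longleftrightarrow> f ` X \<in> indeps N"
    using matroid_isoE[OF iso] by blast
  have "image f ` indeps M = indeps N"
    using matroid_iso_bij_indeps[OF M N f ind] by (simp add: bij_betw_def)
  moreover have "card (f ` I) = card I" if "I \<in> indeps M" for I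
    using inj_on_subset[OF bij_betw_imp_inj_on[OF f] matroid.indeps_subset[OF M that]] by (rule card_image)
  ultimately have "card ` indeps N = card ` indeps M" by (metis (no_types, lifting) image_cong image_image)
  moreover have "{I \<in> indeps M. I \<subseteq> ground M} = indeps M" "{I \<in> indeps N. I \<subseteq> ground N} = indeps N"
    using matroid.indeps_subset[OF M] matroid.indeps_subset[OF N] by auto
  ultimately show ?thesis by (simp add: rank_on_def)
qed

lemma matroid_iso_circuit:
  assumes f: "bij_betw f (ground M) (ground N)"
    and ind: "\<And>X. X \<subseteq> ground M \<Longrightarrow> X \<in> indeps M \<longleftrightarrow> f ` X \<in> indeps N"
    and C: "C \<subseteq> ground M" "f ` C \<in> circuits N"
  shows "C \<in> circuits M"
proof -
  have "D \<in> indeps M" if D: "D \<subset> C" for D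
  proof -
    have "f ` D \<noteq> f ` C"
      using inj_on_image_eq_iff[OF bij_betw_imp_inj_on[OF f], of D C] D C(1) by auto
    then have "f ` D \<subset> f ` C" using D by auto
    then show ?thesis using C D ind[of D] by (auto simp: circuits_def)
  qed
  then show ?thesis using C ind[of C] by (auto simp: circuits_def)
qed

section \<open>Circuits supplied by the conditions on \<open>FI\<close>, and rigidity\<close>

context matroid begin

lemma proper_cyclic_flatD:
  assumes "F \<in> proper_cyclic_flats M"
  shows "F \<subseteq> ground M" "F \<noteq> {}" "F \<noteq> ground M" "is_flat M F"
    "\<And>x. x \<in> F \<Longrightarrow> rank_on M (F - {x}) = rank_on M F"
    "rank_on M F < rank_of M"
proof -
  show 1: "F \<noteq> {}" "F \<noteq> ground M" "is_flat M F" "\<And>x. x \<in> F \<Longrightarrow> rank_on M (F - {x}) = rank_on M F"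
    using assms by (auto simp: proper_cyclic_flats_def is_cyclic_flat_iff)
  then show 2: "F \<subseteq> ground M" by (simp add: is_flat_def)
  then obtain x where x: "x \<in> ground M - F" using 1 by auto
  then have "rank_on M F < rank_on M (insert x F)" using 1 by (simp add: is_flat_def)
  also have "\<dots> \<le> rank_of M" using x 2 by (intro rank_on_mono) auto
  finally show "rank_on M F < rank_of M" .
qed

text \<open>A proper cyclic flat containing \<open>e\<close> has a circuit through \<open>e\<close>,
  and its rank is below that of \<open>M\<close>.\<close>

lemma nonspanning_circuit_through:
  assumes "FI M = {}" "e \<in> ground M"
  obtains C where "C \<in> circuits M" "e \<in> C" "card C \<le> rank_of M"
proof -
  obtain F where F: "F \<in> proper_cyclic_flats M" "e \<in> F" using assms by (auto simp: FI_def)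
  note F' = proper_cyclic_flatD[OF F(1)]
  obtain C where C: "C \<in> circuits M" "e \<in> C" "C \<subseteq> F"
    by (rule circuit_through[OF F'(1) F(2) F'(5)[OF F(2)]])
  have "rank_on M C \<le> rank_on M F" using C by (intro rank_on_mono)
  then have "card C \<le> rank_of M" using card_circuit[OF C(1)] F'(6) by simp
  then show ?thesis using C that by blast
qed

text \<open>The complement of a cyclic flat of the dual is a cyclic flat; here a circuit inside a
  cyclic flat avoiding \<open>e\<close> does not have \<open>e\<close> in its closure.\<close>

lemma circuit_avoiding:
  assumes "FI (dual_matroid M) = {}" "e \<in> ground M"
  obtains C c where "C \<in> circuits M" "c \<in> C" "e \<notin> C" "insert e (C - {c}) \<in> indeps M"
proof -
  interpret D: matroid "dual_matroid M" by (rule matroid_dual_matroid)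
  obtain Z where Z: "Z \<in> proper_cyclic_flats (dual_matroid M)" "e \<in> Z"
    using assms by (auto simp: FI_def)
  note Z' = D.proper_cyclic_flatD[OF Z(1), simplified]
  have finZ: "finite Z" using Z'(1) finite_ground by (rule finite_subset)
  let ?F = "ground M - Z"
  obtain x where x: "x \<in> ground M" "x \<notin> Z" using Z'(1,3) by auto
  \<comment> \<open>Flatness of \<open>Z\<close> in the dual means, by the corank formula, that
    dropping \<open>x\<close> from the complement of \<open>Z\<close> loses no rank; hence there is
    a circuit through \<open>x\<close> that avoids \<open>Z\<close>.\<close>
  have "rank_on (dual_matroid M) Z < rank_on (dual_matroid M) (insert x Z)"
    using Z'(4) x by (simp add: is_flat_def)
  moreover have s: "insert x Z \<subseteq> ground M" using Z'(1) x by auto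
  moreover have "card (insert x Z) = Suc (card Z)" using finZ x by simp
  moreover have "ground M - insert x Z = ?F - {x}" by auto
  ultimately have "rank_on M ?F \<le> rank_on M (?F - {x})"
    using rank_on_dual_matroid[OF Z'(1)] rank_on_dual_matroid[OF s] by auto
  then have "rank_on M (?F - {x}) = rank_on M ?F" using rank_on_mono[of "?F - {x}" ?F] by auto
  moreover have "?F \<subseteq> ground M" "x \<in> ?F" using x by auto
  ultimately obtain C where C: "C \<in> circuits M" "x \<in> C" "C \<subseteq> ?F"
    by (metis circuit_through)
  \<comment> \<open>Cyclicity of \<open>Z\<close> in the dual means that \<open>e\<close> is outside
    the closure of the complement of \<open>Z\<close>, so it can be added to independent sets
    there.\<close>
  have "rank_on (dual_matroid M) (Z - {e}) = rank_on (dual_matroid M) Z" using Z'(5) Z(2) by blast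
  moreover have s': "Z - {e} \<subseteq> ground M" using Z'(1) by auto
  moreover have "card Z = Suc (card (Z - {e}))" using finZ Z(2) by (rule card.remove)
  moreover have "ground M - (Z - {e}) = insert e ?F" using assms by auto
  ultimately have less: "rank_on M ?F < rank_on M (insert e ?F)"
    using rank_on_dual_matroid[OF Z'(1)] rank_on_dual_matroid[OF s'] by (simp del: card_Diff_insert)
  have "C - {x} \<subseteq> ?F" using C by auto
  with circuit_remove_indep[OF C(1,2)]
  obtain B where B: "B \<in> indeps M" "C - {x} \<subseteq> B" "B \<subseteq> ?F" "card B = rank_on M ?F"
    by (rule indep_extend)
  have "insert e B \<in> indeps M"
    using rank_on_insert_eqI[OF B(1,3,4) assms(2)] less by auto
  moreover have "insert e (C - {x}) \<subseteq> insert e B" using B by auto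
  ultimately have "insert e (C - {x}) \<in> indeps M" by (rule indep_mono)
  moreover have "e \<notin> C" using C Z by auto
  ultimately show ?thesis using C that by blast
qed

text \<open>In a minor of an expansion of the right rank, remaining elements of \<open>W\<close> lie in no
  nonspanning circuit and remaining elements of \<open>U\<close> lie in the closure of every nonspanning
  circuit, so neither can occur in a copy of \<open>M\<close>.\<close>

lemma expansion_minor_rigid:
  assumes FI: "FI M = {}" and coFI: "FI (dual_matroid M) = {}" and pos: "0 < rank_of M"
    and U: "finite U" "U \<inter> ground M = {}" and W: "finite W" "W \<inter> (ground M \<union> U) = {}"
    and X: "X \<in> indeps (expansion M U W)" "card X = card U"
    and Y: "Y \<subseteq> ground M \<union> U \<union> W" "X \<inter> Y = {}"
    and iso: "matroid_iso (minor_by (expansion M U W) X Y) M"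
  shows "X = U \<and> Y = W"
proof -
  let ?Q = "expansion M U W" and ?N = "minor_by (expansion M U W) X Y"
  interpret Q: matroid ?Q using expansion_obtainable[OF U W] by simp
  interpret N: matroid ?N by (rule Q.matroid_minor_by[OF X(1)])
  obtain f where f: "bij_betw f (ground ?N) (ground M)"
    and ind: "\<And>X. X \<subseteq> ground ?N \<Longrightarrow> X \<in> indeps ?N \<longleftrightarrow> f ` X \<in> indeps M"
    using matroid_isoE[OF iso] by blast
  let ?P = "ground ?N" and ?R = "ground M"
  have XE: "X \<subseteq> ?R \<union> U \<union> W" using Q.indeps_subset[OF X(1)] by simp
  have P: "?P = ?R \<union> U \<union> W - X - Y" by simp
  have finX: "finite X" by (rule Q.finite_indep[OF X(1)])
  have f_img: "f ` ?P = ?R" and f_inj: "inj_on f ?P" using f by (simp_all add: bij_betw_def)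
  have pull: "\<exists>C' \<subseteq> ?P. f ` C' = C \<and> C' \<in> circuits ?N \<and> card C' = card C" if C: "C \<in> circuits M" for C
  proof -
    have "C \<subseteq> f ` ?P" using circuit_subset_ground[OF C] f_img by simp
    then obtain C' where C': "C' \<subseteq> ?P" "C = f ` C'" unfolding subset_image_iff by blast
    moreover have "C' \<in> circuits ?N"
      by (rule matroid_iso_circuit[OF f ind]) (use C C' in auto)
    moreover have "card C' = card C"
      using C' f_inj by (metis card_image inj_on_subset)
    ultimately show ?thesis by blast
  qed
  \<comment> \<open>Since \<open>card X = card U\<close>, a nonspanning circuit together with
    \<open>X\<close> obeys the cardinality bound, so its dependence must come from the nullity
    bound.\<close>
  have violates: "\<rho> + card U < card ((C \<union> X) \<inter> (?R \<union> U))"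
    if C: "C \<in> circuits ?N" "card C \<le> rank_of M" and \<rho>: "\<rho> = rank_on M ((C \<union> X) \<inter> ?R)" for C \<rho>
  proof -
    have "C \<union> X \<notin> indeps ?Q" using C by (auto simp: circuits_def indeps_minor_by)
    moreover have "C \<union> X \<subseteq> ?R \<union> U \<union> W" using N.circuit_subset_ground[OF C(1)] XE by auto
    moreover have "card (C \<union> X) \<le> rank_of M + card U"
      using card_Un_le[of C X] C(2) X(2) by simp
    ultimately show ?thesis using \<rho> by (auto simp: indeps_expansion)
  qed
  have noW: "w \<notin> ?P" if w: "w \<in> W" for w
  proof
    assume wP: "w \<in> ?P"
    then have "f w \<in> ?R" using f_img by auto
    then obtain C where C: "C \<in> circuits M" "f w \<in> C" "card C \<le> rank_of M"
      by (rule nonspanning_circuit_through[OF FI])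
    then obtain C' where C': "C' \<subseteq> ?P" "f ` C' = C" "C' \<in> circuits ?N" "card C' = card C"
      using pull by blast
    have wC': "w \<in> C'" using C' C(2) wP f_inj by (auto simp: inj_on_def)
    have wRU: "w \<notin> ?R \<union> U" using W w by auto
    \<comment> \<open>The nullity bound does not see \<open>w\<close>, so it still fails for the
      circuit without \<open>w\<close>, although that set is independent.\<close>
    have e: "((C' - {w}) \<union> X) \<inter> (?R \<union> U) = (C' \<union> X) \<inter> (?R \<union> U)"
      "((C' - {w}) \<union> X) \<inter> ?R = (C' \<union> X) \<inter> ?R" using wRU by auto
    have "C' - {w} \<union> X \<in> indeps ?Q"
      using N.circuit_remove_indep[OF C'(3) wC'] by (simp add: indeps_minor_by)
    then show False
      using violates[OF C'(3) _ refl] C(3) C'(4) unfolding indeps_expansion e by simp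
  qed
  have noU: "u \<notin> ?P" if u: "u \<in> U" for u
  proof
    assume uP: "u \<in> ?P"
    then have "f u \<in> ?R" using f_img by auto
    then obtain C c where C: "C \<in> circuits M" "c \<in> C" "f u \<notin> C" "insert (f u) (C - {c}) \<in> indeps M"
      by (rule circuit_avoiding[OF coFI])
    obtain C' where C': "C' \<subseteq> ?P" "f ` C' = C" "C' \<in> circuits ?N" "card C' = card C"
      using pull[OF C(1)] by blast
    then obtain c' where c': "c' \<in> C'" "f c' = c" using C(2) by blast
    have "f ` (C' - {c'}) = C - {c}"
      using c' C' f_inj by (subst inj_on_image_set_diff[of f ?P]) auto
    then have "f ` (insert u (C' - {c'})) \<in> indeps M" using C(4) by simp
    moreover have "insert u (C' - {c'}) \<subseteq> ?P" using uP C' by blast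
    ultimately have "insert u (C' - {c'}) \<in> indeps ?N" using ind by blast
    then have J: "insert u (C' - {c'}) \<union> X \<in> indeps ?Q" by (simp add: indeps_minor_by)
    have finC: "finite C" by (rule finite_circuit[OF C(1)])
    have "card (insert (f u) (C - {c})) = card C"
      using C(2,3) finC card.remove[OF finC C(2)] by (simp del: card_Diff_insert)
    then have "card C \<le> rank_of M" using card_le_rank_on[OF C(4) indeps_subset[OF C(4)]] by simp
    then have viol: "rank_on M ((C' \<union> X) \<inter> ?R) + card U < card ((C' \<union> X) \<inter> (?R \<union> U))"
      using violates[OF C'(3) _ refl] C'(4) by simp
    have uC: "u \<notin> C' \<union> X" using C' C(3) uP by auto
    let ?J = "insert u (C' - {c'}) \<union> X"
    have finJ: "finite (C' \<union> X)" using N.finite_circuit[OF C'(3)] finX by simp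
    have uR: "u \<notin> ?R" using U u by auto
    \<comment> \<open>Exchanging \<open>c'\<close> for \<open>u\<close> cannot decrease the number
      of elements in \<open>ground M \<union> U\<close>, and \<open>u\<close> adds no rank in
      \<open>M\<close>. The nullity bound would therefore still fail, against the independence of
      \<open>?J\<close>.\<close>
    have "(C' \<union> X) \<inter> (?R \<union> U) \<subseteq> insert c' (?J \<inter> (?R \<union> U) - {u})" using uC by auto
    then have "card ((C' \<union> X) \<inter> (?R \<union> U)) \<le> card (insert c' (?J \<inter> (?R \<union> U) - {u}))"
      using finJ by (intro card_mono) auto
    also have "\<dots> \<le> Suc (card (?J \<inter> (?R \<union> U) - {u}))" using finJ by (simp add: card_insert_if)
    also have "\<dots> = card (?J \<inter> (?R \<union> U))"
      using finJ u by (intro card.remove[symmetric]) auto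
    also have "\<dots> \<le> rank_on M (?J \<inter> ?R) + card U" using J by (simp add: indeps_expansion)
    also have "\<dots> \<le> rank_on M ((C' \<union> X) \<inter> ?R) + card U"
      using uR by (intro add_right_mono rank_on_mono) auto
    finally show False using viol by simp
  qed
  have "?P \<subseteq> ?R" using noW noU by auto
  then have PR: "?P = ?R"
    using matroid_iso_card_ground[OF iso] by (intro card_subset_eq finite_ground) simp_all
  then have XYU: "X \<inter> ?R = {}" "Y \<inter> ?R = {}" by auto
  have XY: "X \<union> Y = U \<union> W" using PR XYU XE Y(1) U W by auto
  \<comment> \<open>If \<open>X\<close> missed part of \<open>U\<close>, the minor would have
    nullity to spare: every independent set of \<open>M\<close> stays independent and some
    nonspanning circuit joins them, which changes the number of independent sets.\<close>
  have "X \<inter> U = U"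
  proof (rule ccontr)
    assume "X \<inter> U \<noteq> U"
    then have less: "card (X \<inter> U) < card U" using U by (intro psubset_card_mono) auto
    have iff: "I \<in> indeps ?N \<longleftrightarrow>
        I \<subseteq> ?R \<and> card I \<le> rank_of M \<and> card I + card (X \<inter> U) \<le> rank_on M I + card U" for I
    proof (cases "I \<subseteq> ?R")
      case True
      have finI: "finite I" using True finite_ground by (rule finite_subset)
      have disj: "I \<inter> X = {}" "I \<inter> (X \<inter> U) = {}" using True XYU by auto
      have IX: "card (I \<union> X) = card I + card U" "card (I \<union> (X \<inter> U)) = card I + card (X \<inter> U)"
        using card_Un_disjoint[OF finI finX disj(1)] card_Un_disjoint[OF finI _ disj(2)] finX X(2)
        by simp_all
      have e: "(I \<union> X) \<inter> (?R \<union> U) = I \<union> (X \<inter> U)" "(I \<union> X) \<inter> ?R = I" using True XYU by auto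
      have "I \<subseteq> ground ?Q - X - Y" using True PR by simp
      then show ?thesis using True XE
        unfolding indeps_minor_by indeps_expansion e IX by auto
    next
      case False
      then show ?thesis using N.indeps_subset[of I] PR by auto
    qed
    have sub: "indeps M \<subseteq> indeps ?N"
    proof
      fix I assume I: "I \<in> indeps M"
      then show "I \<in> indeps ?N"
        using card_le_rank_on[OF I indeps_subset[OF I]] rank_on_indep[OF I] indeps_subset[OF I] less
        by (simp add: iff)
    qed
    obtain e where "e \<in> ?R" using pos rank_on_le_card[OF finite_ground] by fastforce
    then obtain C where C: "C \<in> circuits M" "card C \<le> rank_of M"
      by (rule nonspanning_circuit_through[OF FI])
    have "C \<in> indeps ?N"
      using C card_circuit[OF C(1)] circuit_subset_ground[OF C(1)] less by (simp add: iff)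
    moreover have "C \<notin> indeps M" using C by (simp add: circuits_def)
    ultimately have "card (indeps M) < card (indeps ?N)"
      using sub N.finite_indeps by (intro psubset_card_mono) auto
    then show False using matroid_iso_card_indeps[OF N.matroid_axioms matroid_axioms iso] by simp
  qed
  then have "U \<subseteq> X" by auto
  then have "X = U" using finX X(2) by (metis card_subset_eq)
  then show ?thesis using XY Y W by auto
qed

section \<open>Copies of matroids in an intertwine, and bounds on its size\<close>

lemma has_minor_isoE:
  assumes N: "matroid N" and "has_minor_iso M N"
  obtains X Y where "X \<in> indeps M" "Y \<subseteq> ground M" "X \<inter> Y = {}" "matroid_iso (minor_by M X Y) N"
    "card X + rank_of N = rank_of M" "card X + card Y + card (ground N) = card (ground M)"
proof -
  obtain N' where "minor_of N' M" and iso: "matroid_iso N' N"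
    using assms by (auto simp: has_minor_iso_def)
  then obtain X Y where XY: "X \<in> indeps M" "Y \<subseteq> ground M" "X \<inter> Y = {}" "N' = minor_by M X Y"
    and r: "rank_of N' + card X = rank_of M"
    by (metis minor_ofE)
  have "matroid N'" unfolding XY(4) by (rule matroid_minor_by[OF XY(1)])
  then have r': "card X + rank_of N = rank_of M" using matroid_iso_rank_of[OF _ N iso] r by simp
  have XE: "X \<subseteq> ground M" by (rule indeps_subset[OF XY(1)])
  have "ground M = X \<union> Y \<union> (ground M - X - Y)" using XE XY by auto
  also have "card \<dots> = card (X \<union> Y) + card (ground M - X - Y)"
    using XE XY finite_ground by (intro card_Un_disjoint) (auto intro: finite_subset)
  also have "card (X \<union> Y) = card X + card Y"
    using XE XY finite_ground by (intro card_Un_disjoint) (auto intro: finite_subset)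
  also have "card (ground M - X - Y) = card (ground N)"
    using matroid_iso_card_ground[OF iso] XY(4) by simp
  finally show ?thesis using that XY iso r' by simp
qed

text \<open>The removal can be done in two stages, first \<open>X'\<close> and \<open>Y'\<close>,
  then the rest.\<close>

lemma has_minor_iso_minor_by:
  assumes "X \<in> indeps M" "Y \<subseteq> ground M" "X \<inter> Y = {}" "matroid_iso (minor_by M X Y) N"
    and "X' \<subseteq> X" "Y' \<subseteq> Y"
  shows "has_minor_iso (minor_by M X' Y') N"
proof -
  have X': "X' \<in> indeps M" using assms indep_mono by blast
  interpret M': matroid "minor_by M X' Y'" by (rule matroid_minor_by[OF X'])
  have sub: "X - X' \<subseteq> ground M - X' - Y'" using indeps_subset[OF assms(1)] assms by auto
  have "X - X' \<in> indeps (minor_by M X' Y')"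
    using sub assms(1,5) by (simp add: indeps_minor_by Un_absorb2)
  then have "minor_of (minor_by (minor_by M X' Y') (X - X') (Y - Y')) (minor_by M X' Y')"
    using assms by (intro M'.minor_of_minor_by) auto
  moreover have "minor_by (minor_by M X' Y') (X - X') (Y - Y') = minor_by M X Y"
    using minor_by_minor_by[OF sub] assms(5,6) by (simp add: Un_absorb1)
  ultimately show ?thesis using assms by (auto simp: has_minor_iso_def)
qed

text \<open>Elements that both copies contract, or both delete, can be removed at the outset without
  losing either copy. Minimality leaves no such elements.\<close>

lemma intertwine_minors_disjoint:
  assumes inter: "is_intertwine M N1 N2"
    and 1: "X1 \<in> indeps M" "Y1 \<subseteq> ground M" "X1 \<inter> Y1 = {}" "matroid_iso (minor_by M X1 Y1) N1"
    and 2: "X2 \<in> indeps M" "Y2 \<subseteq> ground M" "X2 \<inter> Y2 = {}" "matroid_iso (minor_by M X2 Y2) N2"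
  shows "X1 \<inter> X2 = {} \<and> Y1 \<inter> Y2 = {}"
proof -
  let ?X = "X1 \<inter> X2" and ?Y = "Y1 \<inter> Y2"
  have "?X \<in> indeps M" using 1(1) by (rule indep_mono) auto
  then have "minor_of (minor_by M ?X ?Y) M" using 1 by (intro minor_of_minor_by) auto
  moreover have "has_minor_iso (minor_by M ?X ?Y) N1" using 1 by (rule has_minor_iso_minor_by) auto
  moreover have "has_minor_iso (minor_by M ?X ?Y) N2" using 2 by (rule has_minor_iso_minor_by) auto
  ultimately have "minor_by M ?X ?Y = M"
    using inter unfolding is_intertwine_def proper_minor_of_def by blast
  then have "ground M - ?X - ?Y = ground M" by (metis ground_minor_by)
  moreover have "?X \<subseteq> ground M" "?Y \<subseteq> ground M" using indeps_subset[OF 1(1)] 1 by auto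
  ultimately show ?thesis by auto
qed

end

text \<open>The disjoint contracted sets have \<open>rank_of M - rank_of N1\<close> and
  \<open>rank_of M - rank_of N2\<close> elements and fit into the ground set: the lower bound. The
  same count for the disjoint deleted sets gives the upper bound.\<close>

lemma intertwine_card_bounds:
  fixes M :: "'b set_system" and N1 N2 :: "'a set_system"
  assumes N1: "matroid N1" and N2: "matroid N2" and inter: "is_intertwine M N1 N2"
  shows "2 * int (rank_of M) - int (rank_of N1) - int (rank_of N2) \<le> int (card (ground M))"
    and "int (card (ground M)) \<le> 2 * int (rank_of M)
      + int (rank_of (dual_matroid N1)) + int (rank_of (dual_matroid N2))"
proof -
  interpret M: matroid M using inter by (simp add: is_intertwine_def)
  have h1: "has_minor_iso M N1" and h2: "has_minor_iso M N2"
    using inter by (simp_all add: is_intertwine_def)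
  obtain X1 Y1 where 1: "X1 \<in> indeps M" "Y1 \<subseteq> ground M" "X1 \<inter> Y1 = {}"
    "matroid_iso (minor_by M X1 Y1) N1" "card X1 + rank_of N1 = rank_of M"
    "card X1 + card Y1 + card (ground N1) = card (ground M)"
    by (rule M.has_minor_isoE[OF N1 h1])
  obtain X2 Y2 where 2: "X2 \<in> indeps M" "Y2 \<subseteq> ground M" "X2 \<inter> Y2 = {}"
    "matroid_iso (minor_by M X2 Y2) N2" "card X2 + rank_of N2 = rank_of M"
    "card X2 + card Y2 + card (ground N2) = card (ground M)"
    by (rule M.has_minor_isoE[OF N2 h2])
  have disj: "X1 \<inter> X2 = {}" "Y1 \<inter> Y2 = {}"
    using M.intertwine_minors_disjoint[OF inter 1(1-4) 2(1-4)] by auto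
  have X: "X1 \<subseteq> ground M" "X2 \<subseteq> ground M" using M.indeps_subset 1(1) 2(1) by auto
  have fin: "finite X1" "finite X2" "finite Y1" "finite Y2"
    using X 1(2) 2(2) by (auto intro: finite_subset[OF _ M.finite_ground])
  have "card X1 + card X2 = card (X1 \<union> X2)" using fin disj by (intro card_Un_disjoint[symmetric])
  also have "\<dots> \<le> card (ground M)" using X M.finite_ground by (intro card_mono) auto
  finally have x: "card X1 + card X2 \<le> card (ground M)" .
  have "card Y1 + card Y2 = card (Y1 \<union> Y2)" using fin disj by (intro card_Un_disjoint[symmetric])
  also have "\<dots> \<le> card (ground M)" using 1 2 M.finite_ground by (intro card_mono) auto
  finally have y: "card Y1 + card Y2 \<le> card (ground M)" .
  show "2 * int (rank_of M) - int (rank_of N1) - int (rank_of N2) \<le> int (card (ground M))"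
    using x 1(5) 2(5) by linarith
  show "int (card (ground M)) \<le> 2 * int (rank_of M)
      + int (rank_of (dual_matroid N1)) + int (rank_of (dual_matroid N2))"
    using y 1(5,6) 2(5,6) matroid.rank_of_dual_matroid[OF N1] matroid.rank_of_dual_matroid[OF N2]
    by linarith
qed

section \<open>The combined matroid\<close>

text \<open>In the notation of the construction, \<open>V1 = U1 \<union> A2\<close>, \<open>W1 = U2 \<union> (R2 - A2)\<close>, and
  symmetrically for \<open>V2\<close>, \<open>W2\<close>: the first matroid is recovered by contracting \<open>V1\<close> and
  deleting \<open>W1\<close>.\<close>

locale two_expansions = N1: matroid N1 + N2: matroid N2
  for N1 N2 :: "'a set_system" +
  fixes V1 W1 V2 W2 E :: "'a set" and k :: nat
  assumes finite_E: "finite E"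
    and E1: "E = ground N1 \<union> V1 \<union> W1" and E2: "E = ground N2 \<union> V2 \<union> W2"
    and disj1: "V1 \<inter> ground N1 = {}" "W1 \<inter> (ground N1 \<union> V1) = {}"
    and disj2: "V2 \<inter> ground N2 = {}" "W2 \<inter> (ground N2 \<union> V2) = {}"
    and VV: "V1 \<inter> V2 = {}" and WW: "W1 \<inter> W2 = {}"
    and overlap: "(ground N1 \<union> V1) \<inter> (ground N2 \<union> V2) \<subseteq> ground N1 \<union> ground N2"
    and k1: "card V1 + rank_of N1 = k" and k2: "card V2 + rank_of N2 = k"
    and big1: "4 * card (ground N1) \<le> k" and big2: "4 * card (ground N2) \<le> k"
    and pos1: "0 < rank_of N1" and pos2: "0 < rank_of N2"
    and FI1: "FI N1 = {}" "FI (dual_matroid N1) = {}"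
    and FI2: "FI N2 = {}" "FI (dual_matroid N2) = {}"
begin

text \<open>The assumptions are symmetric, so each fact is proved for the first side and read off
  for the second through a local interpretation \<open>sw\<close>.\<close>

lemma two_expansions_swap: "two_expansions N2 N1 V2 W2 V1 W1 E k"
  by unfold_locales
    (use finite_E E1 E2 disj1 disj2 VV WW overlap k1 k2 big1 big2 pos1 pos2 FI1 FI2 in auto)

definition joint :: "'a set_system" where
  "joint = \<lparr>ground = E, indeps = indeps (expansion N1 V1 W1) \<inter> indeps (expansion N2 V2 W2)\<rparr>"

lemma ground_joint [simp]: "ground joint = E"
  by (simp add: joint_def)

lemma indeps_joint:
  "I \<in> indeps joint \<longleftrightarrow> I \<in> indeps (expansion N1 V1 W1) \<and> I \<in> indeps (expansion N2 V2 W2)"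
  by (simp add: joint_def)

lemma finite_V1: "finite V1" and finite_W1: "finite W1"
  using finite_E E1 by auto

lemma indeps_expansion1:
  "I \<in> indeps (expansion N1 V1 W1) \<longleftrightarrow> I \<subseteq> E \<and> card I \<le> k \<and>
    card (I \<inter> (ground N1 \<union> V1)) \<le> rank_on N1 (I \<inter> ground N1) + card V1"
  using k1 by (simp add: indeps_expansion E1 add.commute)

lemma expansion1: "matroid (expansion N1 V1 W1)" "obtainable_from N1 (expansion N1 V1 W1)"
  using N1.expansion_obtainable[OF finite_V1 disj1(1) finite_W1 disj1(2)] by auto

section \<open>Tight sets and the augmentation axiom\<close>

lemma rank_le_card: "rank_of N1 \<le> card (ground N1)" "rank_of N2 \<le> card (ground N2)"
  by (simp_all add: N1.rank_on_le_card N1.finite_ground N2.rank_on_le_card N2.finite_ground)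

text \<open>Equality in the nullity bound of the first expansion. Below size \<open>k\<close>, this
  is the only thing that can stop an element of \<open>E\<close> from being added.\<close>

definition tight :: "'a set \<Rightarrow> bool" where
  "tight I \<longleftrightarrow> card (I \<inter> (ground N1 \<union> V1)) = rank_on N1 (I \<inter> ground N1) + card V1"

lemma insert_expansion1_if_not_tight:
  assumes "I \<in> indeps (expansion N1 V1 W1)" "card I < k" "\<not> tight I" "x \<in> E"
  shows "insert x I \<in> indeps (expansion N1 V1 W1)"
proof -
  have finI: "finite I" using assms(1) finite_E finite_subset by (auto simp: indeps_expansion1)
  have "card (insert x I \<inter> (ground N1 \<union> V1)) \<le> card (insert x (I \<inter> (ground N1 \<union> V1)))"
    using finI by (intro card_mono) auto
  also have "\<dots> \<le> Suc (card (I \<inter> (ground N1 \<union> V1)))" using finI by (simp add: card_insert_if)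
  also have "\<dots> \<le> rank_on N1 (I \<inter> ground N1) + card V1"
    using assms by (simp add: indeps_expansion1 tight_def)
  also have "\<dots> \<le> rank_on N1 (insert x I \<inter> ground N1) + card V1"
    by (intro add_right_mono N1.rank_on_mono) auto
  finally show ?thesis using assms finI by (simp add: indeps_expansion1 card_insert_if)
qed

text \<open>A tight set has at least \<open>card V1\<close> elements in
  \<open>ground N1 \<union> V1\<close>, and likewise on the other side. The overlap has at most
  \<open>card (ground N1) + card (ground N2)\<close> elements, so a doubly tight set would have at
  least \<open>k\<close> elements; the factor 4 in \<open>big1\<close> and \<open>big2\<close> is
  what this count needs.\<close>

lemma not_both_tight:
  assumes I: "I \<subseteq> E" "card I < k" and "tight I"
  shows "\<not> two_expansions.tight N2 V2 I"
proof
  interpret sw: two_expansions N2 N1 V2 W2 V1 W1 E k by (rule two_expansions_swap)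
  assume t2: "sw.tight I"
  let ?A = "I \<inter> (ground N1 \<union> V1)" and ?B = "I \<inter> (ground N2 \<union> V2)"
  have finI: "finite I" using I finite_E finite_subset by auto
  have "card ?A + card ?B = card (?A \<union> ?B) + card (?A \<inter> ?B)"
    using finI by (intro card_Un_Int) auto
  moreover have "card (?A \<union> ?B) \<le> card I" using finI by (intro card_mono) auto
  moreover have "card (?A \<inter> ?B) \<le> card (ground N1) + card (ground N2)"
  proof -
    have "card (?A \<inter> ?B) \<le> card (ground N1 \<union> ground N2)"
      using overlap N1.finite_ground N2.finite_ground by (intro card_mono) auto
    then show ?thesis using card_Un_le[of "ground N1" "ground N2"] by simp
  qed
  ultimately show False
    using \<open>tight I\<close> t2 I(2) k1 k2 big1 big2 rank_le_card unfolding tight_def sw.tight_def by linarith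
qed

text \<open>At most one of the two constraints is tight for \<open>I\<close>. Augmentation in the
  expansion where it may be tight yields an element, and the other expansion accepts every
  element.\<close>

lemma matroid_joint: "matroid joint"
proof -
  interpret sw: two_expansions N2 N1 V2 W2 V1 W1 E k by (rule two_expansions_swap)
  interpret Q1: matroid "expansion N1 V1 W1" by (rule expansion1)
  interpret Q2: matroid "expansion N2 V2 W2" by (rule sw.expansion1)
  show ?thesis
  proof
    fix I J assume I: "I \<in> indeps joint" and J: "J \<in> indeps joint" and less: "card I < card J"
    have IE: "I \<subseteq> E" "J \<subseteq> E" and k: "card I < k"
      using I J less by (auto simp: indeps_joint indeps_expansion1)
    show "\<exists>x \<in> J - I. insert x I \<in> indeps joint"
    proof (cases "tight I")
      case True
      then have n: "\<not> sw.tight I" using not_both_tight IE k by auto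
      then show ?thesis
        using Q1.indep_augment[of I J] I J less k IE sw.insert_expansion1_if_not_tight[OF _ k n]
        by (auto simp: indeps_joint)
    next
      case False
      then show ?thesis
        using Q2.indep_augment[of I J] I J less k IE insert_expansion1_if_not_tight[OF _ k False]
        by (auto simp: indeps_joint)
    qed
  next
    fix I J assume "I \<in> indeps joint" "J \<subseteq> I"
    then show "J \<in> indeps joint"
      using Q1.indep_mono[of I J] Q2.indep_mono[of I J] by (auto simp: indeps_joint)
  qed (auto simp: indeps_joint finite_E indeps_expansion1 Q1.empty_indep Q2.empty_indep)
qed

lemma joint_swap: "two_expansions.joint N2 N1 V2 W2 V1 W1 E = joint"
proof -
  interpret sw: two_expansions N2 N1 V2 W2 V1 W1 E k by (rule two_expansions_swap)
  show ?thesis unfolding sw.joint_def joint_def by (simp add: Int_commute)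
qed

section \<open>Cyclic flats of the combined matroid and their ranks\<close>

interpretation J: matroid joint by (rule matroid_joint)

text \<open>Such a set has so few elements in \<open>ground N2 \<union> V2\<close> that the second
  nullity bound holds anyway. The additional \<open>x\<close> is there for testing whether sets near
  \<open>ground N1 \<union> V1\<close> are flats.\<close>

lemma joint_near1:
  assumes I: "I \<in> indeps (expansion N1 V1 W1)" "I \<subseteq> insert x (ground N1 \<union> V1)"
  shows "I \<in> indeps joint"
proof -
  interpret sw: two_expansions N2 N1 V2 W2 V1 W1 E k by (rule two_expansions_swap)
  have "I \<inter> (ground N2 \<union> V2) \<subseteq> insert x (ground N1 \<union> ground N2)" using I(2) overlap by auto
  then have "card (I \<inter> (ground N2 \<union> V2)) \<le> card (insert x (ground N1 \<union> ground N2))"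
    using N1.finite_ground N2.finite_ground by (intro card_mono) auto
  also have "\<dots> \<le> Suc (card (ground N1) + card (ground N2))"
    using N1.finite_ground N2.finite_ground card_Un_le[of "ground N1" "ground N2"]
    by (simp add: card_insert_if)
  \<comment> \<open>Positive rank makes \<open>ground N1\<close> nonempty, which pays for the one
    extra element.\<close>
  also have "\<dots> \<le> card V2" using k2 big1 big2 rank_le_card pos1 by linarith
  finally show ?thesis using I(1) by (simp add: indeps_joint indeps_expansion1 sw.indeps_expansion1)
qed

text \<open>The elements of \<open>V1\<close> use up the whole nullity allowance
  \<open>card V1\<close>, so nothing is left for \<open>B\<close>.\<close>

lemma indep_Un_V1:
  assumes "B \<subseteq> ground N1"
  shows "B \<union> V1 \<in> indeps joint \<longleftrightarrow> B \<in> indeps N1"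
proof -
  have finB: "finite B" using assms N1.finite_ground by (rule finite_subset)
  have c: "card (B \<union> V1) = card B + card V1"
    using finB finite_V1 assms disj1 by (intro card_Un_disjoint) auto
  have e: "(B \<union> V1) \<inter> (ground N1 \<union> V1) = B \<union> V1" "(B \<union> V1) \<inter> ground N1 = B"
    using assms disj1 by auto
  have "B \<union> V1 \<in> indeps (expansion N1 V1 W1) \<longleftrightarrow> B \<in> indeps N1"
    unfolding indeps_expansion1 e c N1.indep_iff_rank_on[OF assms]
    using E1 assms k1 N1.rank_on_mono[OF assms] by auto
  \<comment> \<open>No extra element is wanted here, so an arbitrary value stands in for the one in
    \<open>joint_near1\<close>.\<close>
  moreover have "B \<union> V1 \<subseteq> insert undefined (ground N1 \<union> V1)" using assms by auto
  ultimately show ?thesis using joint_near1 by (auto simp: indeps_joint)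
qed

lemma rank_joint_Un_V1:
  assumes F: "F \<subseteq> ground N1"
  shows "rank_on joint (F \<union> V1) = rank_on N1 F + card V1"
proof (rule antisym)
  show "rank_on joint (F \<union> V1) \<le> rank_on N1 F + card V1"
  proof (rule J.rank_on_le)
    fix I assume I: "I \<in> indeps joint" "I \<subseteq> F \<union> V1"
    then have "I \<inter> (ground N1 \<union> V1) = I" using F by auto
    then have "card I \<le> rank_on N1 (I \<inter> ground N1) + card V1"
      using I by (simp add: indeps_joint indeps_expansion1)
    also have "rank_on N1 (I \<inter> ground N1) \<le> rank_on N1 F"
      using I disj1 by (intro N1.rank_on_mono) auto
    finally show "card I \<le> rank_on N1 F + card V1" by simp
  qed
  obtain B where B: "B \<in> indeps N1" "B \<subseteq> F" "card B = rank_on N1 F" by (rule N1.rank_on_witness)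
  have "card (B \<union> V1) \<le> rank_on joint (F \<union> V1)"
    using B F by (intro J.card_le_rank_on) (auto simp: indep_Un_V1)
  moreover have "card (B \<union> V1) = card B + card V1"
    using B F disj1 N1.finite_indep[OF B(1)] finite_V1 by (intro card_Un_disjoint) auto
  ultimately show "rank_on N1 F + card V1 \<le> rank_on joint (F \<union> V1)" using B by simp
qed

lemma rank_of_joint: "rank_of joint = k"
proof (rule antisym)
  show "rank_of joint \<le> k"
    by (rule J.rank_on_le) (simp add: indeps_joint indeps_expansion1)
  have "rank_on joint (ground N1 \<union> V1) \<le> rank_of joint"
    unfolding ground_joint using E1 by (intro J.rank_on_mono) auto
  then show "k \<le> rank_of joint" using rank_joint_Un_V1[of "ground N1"] k1 by simp
qed

text \<open>As \<open>FI N1 = {}\<close>, every element of \<open>N1\<close> lies in a circuit, so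
  \<open>ground N1 - {x}\<close> still has full rank and spans together with
  \<open>V1\<close>.\<close>

lemma rank_joint_remove_if_notin_V1:
  assumes "x \<in> E" "x \<notin> V1"
  shows "rank_on joint (E - {x}) = k"
proof (rule antisym)
  show "rank_on joint (E - {x}) \<le> k" using rank_of_joint J.rank_on_mono[of "E - {x}" E] by simp
  have "rank_on N1 (ground N1 - {x}) = rank_of N1"
  proof (cases "x \<in> ground N1")
    case True
    then obtain C where "C \<in> circuits N1" "x \<in> C"
      using N1.nonspanning_circuit_through[OF FI1(1)] by metis
    then show ?thesis using N1.circuit_subset_ground by (intro N1.rank_on_remove_circuit)
  qed simp
  moreover have "rank_on joint ((ground N1 - {x}) \<union> V1) \<le> rank_on joint (E - {x})"
    using E1 assms by (intro J.rank_on_mono) auto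
  moreover have "rank_on joint ((ground N1 - {x}) \<union> V1) = rank_on N1 (ground N1 - {x}) + card V1"
    by (rule rank_joint_Un_V1) auto
  ultimately show "k \<le> rank_on joint (E - {x})" using k1 by simp
qed

text \<open>\<open>V1\<close> and \<open>V2\<close> are disjoint, so every element avoids one of
  them and can be removed without loss of rank by the corresponding side.\<close>

lemma is_cyclic_flat_ground_joint: "is_cyclic_flat joint E"
proof -
  interpret sw: two_expansions N2 N1 V2 W2 V1 W1 E k by (rule two_expansions_swap)
  have "rank_on joint (E - {x}) = k" if "x \<in> E" for x
    using rank_joint_remove_if_notin_V1[of x] sw.rank_joint_remove_if_notin_V1[of x] VV that
    unfolding joint_swap by auto
  then show ?thesis using rank_of_joint by (simp add: J.is_cyclic_flat_iff is_flat_def)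
qed

text \<open>There are no loops: \<open>V1\<close> is nonempty, so the nullity bound allows every
  single element.\<close>

lemma is_cyclic_flat_empty_joint: "is_cyclic_flat joint {}"
proof -
  have "rank_on joint {} < rank_on joint {x}" if x: "x \<in> E" for x
  proof -
    have "1 \<le> card V1" using k1 big1 rank_le_card pos1 by linarith
    moreover have "card ({x} \<inter> (ground N1 \<union> V1)) \<le> 1"
      using card_mono[of "{x}" "{x} \<inter> (ground N1 \<union> V1)"] by simp
    ultimately have "{x} \<in> indeps (expansion N1 V1 W1)"
      using x k1 by (simp add: indeps_expansion1)
    then have "{x} \<in> indeps joint" by (rule joint_near1[where x = x]) simp
    then have "rank_on joint {x} = 1" by (simp add: J.rank_on_indep)
    then show ?thesis using J.rank_on_le_card[of "{}"] by simp
  qed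
  then show ?thesis by (simp add: J.is_cyclic_flat_iff is_flat_def)
qed

lemma is_cyclic_flat_Un_V1:
  assumes F: "F \<in> proper_cyclic_flats N1"
  shows "is_cyclic_flat joint (F \<union> V1)"
proof -
  note F' = N1.proper_cyclic_flatD[OF F]
  have rank: "rank_on joint (F \<union> V1) = rank_on N1 F + card V1" by (rule rank_joint_Un_V1[OF F'(1)])
  have finF: "finite F" using F'(1) N1.finite_ground by (rule finite_subset)
  obtain y where y: "y \<in> F" using F'(2) by auto
  \<comment> \<open>A basis of the cyclic flat \<open>F\<close> can be chosen to miss
    \<open>y\<close>; then \<open>y\<close> is available to replace an element of
    \<open>V1\<close>.\<close>
  obtain B where B: "B \<in> indeps N1" "B \<subseteq> F - {y}" "card B = rank_on N1 (F - {y})"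
    by (rule N1.rank_on_witness)
  have cB: "card B = rank_on N1 F" using B(3) F'(5)[OF y] by simp
  have finB: "finite B" by (rule N1.finite_indep[OF B(1)])
  have flat: "rank_on joint (F \<union> V1) < rank_on joint (insert x (F \<union> V1))"
    if x: "x \<in> E" "x \<notin> F \<union> V1" for x
  proof (cases "x \<in> ground N1")
    case True
    then have "rank_on N1 F < rank_on N1 (insert x F)" using F'(4) x by (simp add: is_flat_def)
    then show ?thesis using rank rank_joint_Un_V1[of "insert x F"] True F'(1) by simp
  next
    case False
    \<comment> \<open>Outside \<open>ground N1 \<union> V1\<close> only the cardinality bound
      matters, and it leaves room because \<open>F\<close> does not span \<open>N1\<close>.\<close>
    let ?I = "insert x (B \<union> V1)"
    have "card (B \<union> V1) = card B + card V1"
      using B F'(1) disj1 finB finite_V1 by (intro card_Un_disjoint) auto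
    moreover have "x \<notin> B \<union> V1" using x B by auto
    ultimately have c: "card ?I = Suc (card B + card V1)" "card (B \<union> V1) = card B + card V1"
      using finB finite_V1 by simp_all
    have e: "?I \<inter> (ground N1 \<union> V1) = B \<union> V1" "?I \<inter> ground N1 = B"
      using False x B F'(1) disj1 by auto
    have "?I \<in> indeps (expansion N1 V1 W1)"
      unfolding indeps_expansion1 e c
      using x E1 B F'(1,6) cB k1 N1.rank_on_indep[OF B(1)] by auto
    then have "?I \<in> indeps joint" by (rule joint_near1[where x = x]) (use B F'(1) in auto)
    then have "card ?I \<le> rank_on joint (insert x (F \<union> V1))" using B by (intro J.card_le_rank_on) auto
    then show ?thesis using c cB rank by simp
  qed
  have cyc: "rank_on joint (F \<union> V1 - {x}) = rank_on joint (F \<union> V1)" if x: "x \<in> F \<union> V1" for x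
  proof (rule antisym)
    show "rank_on joint (F \<union> V1 - {x}) \<le> rank_on joint (F \<union> V1)" by (rule J.rank_on_mono) auto
    show "rank_on joint (F \<union> V1) \<le> rank_on joint (F \<union> V1 - {x})"
    proof (cases "x \<in> F")
      case True
      then have "F \<union> V1 - {x} = (F - {x}) \<union> V1" using disj1 F'(1) by auto
      moreover have "F - {x} \<subseteq> ground N1" using F'(1) by auto
      ultimately show ?thesis using rank rank_joint_Un_V1[of "F - {x}"] F'(5)[OF True] by simp
    next
      case False
      then have xV: "x \<in> V1" using x by simp
      \<comment> \<open>The nullity that \<open>y\<close> adds to \<open>B\<close> is covered by the
        unit set free when \<open>x\<close> leaves \<open>V1\<close>.\<close>
      let ?I = "insert y B \<union> (V1 - {x})"
      have "card ?I = card (insert y B) + card (V1 - {x})"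
        using B y F'(1) disj1 finB finite_V1 by (intro card_Un_disjoint) auto
      moreover have "card (insert y B) = Suc (card B)" using finB B by (subst card_insert_disjoint) auto
      moreover have "card V1 = Suc (card (V1 - {x}))" using finite_V1 xV by (rule card.remove)
      ultimately have c: "card ?I = card B + card V1" by (simp del: card_Diff_insert)
      have e: "?I \<inter> (ground N1 \<union> V1) = ?I" "?I \<inter> ground N1 = insert y B"
        using B y F'(1) disj1 by auto
      have "card B \<le> rank_on N1 (insert y B)" using B by (intro N1.card_le_rank_on) auto
      then have "?I \<in> indeps (expansion N1 V1 W1)"
        unfolding indeps_expansion1 e c using E1 B y F'(1,6) cB k1 by auto
      then have "?I \<in> indeps joint"
        by (rule joint_near1[where x = x]) (use B y F'(1) in auto)
      then have "card ?I \<le> rank_on joint (F \<union> V1 - {x})"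
        using B y False by (intro J.card_le_rank_on) auto
      then show ?thesis using c cB rank by simp
    qed
  qed
  have "F \<union> V1 \<subseteq> E" using E1 F'(1) by auto
  then show ?thesis
    unfolding J.is_cyclic_flat_iff is_flat_def ground_joint using flat cyc by blast
qed

lemma insert_expansion1_if_tight:
  assumes B: "B \<in> indeps (expansion N1 V1 W1)" "card B < k" "tight B" and x: "x \<in> E" "x \<notin> B"
  shows "insert x B \<in> indeps (expansion N1 V1 W1) \<longleftrightarrow>
    x \<notin> V1 \<and> x \<notin> N1.cl (B \<inter> ground N1)"
proof -
  have BE: "B \<subseteq> E" using B by (simp add: indeps_expansion1)
  have finB: "finite B" using BE finite_E by (rule finite_subset)
  have 0: "insert x B \<in> indeps (expansion N1 V1 W1) \<longleftrightarrow>
    card (insert x B \<inter> (ground N1 \<union> V1)) \<le> rank_on N1 (insert x B \<inter> ground N1) + card V1"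
    using B x BE finB by (simp add: indeps_expansion1)
  consider "x \<in> ground N1" "x \<notin> V1" | "x \<in> V1" "x \<notin> ground N1" | "x \<notin> ground N1" "x \<notin> V1"
    using disj1 by auto
  then show ?thesis
  proof cases
    case 1
    have e: "insert x B \<inter> (ground N1 \<union> V1) = insert x (B \<inter> (ground N1 \<union> V1))"
      "insert x B \<inter> ground N1 = insert x (B \<inter> ground N1)" using 1 by auto
    have "x \<notin> B \<inter> (ground N1 \<union> V1)" using x by simp
    then have c: "card (insert x (B \<inter> (ground N1 \<union> V1))) = Suc (card (B \<inter> (ground N1 \<union> V1)))"
      using finB by (intro card_insert_disjoint) auto
    have "rank_on N1 (B \<inter> ground N1) \<le> rank_on N1 (insert x (B \<inter> ground N1))"
      by (rule N1.rank_on_mono) auto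
    then show ?thesis unfolding 0 unfolding e c using 1 B(3) by (auto simp: tight_def N1.cl_def)
  next
    case 2
    have e: "insert x B \<inter> (ground N1 \<union> V1) = insert x (B \<inter> (ground N1 \<union> V1))"
      "insert x B \<inter> ground N1 = B \<inter> ground N1" using 2 by auto
    have "x \<notin> B \<inter> (ground N1 \<union> V1)" using x by simp
    then have c: "card (insert x (B \<inter> (ground N1 \<union> V1))) = Suc (card (B \<inter> (ground N1 \<union> V1)))"
      using finB by (intro card_insert_disjoint) auto
    show ?thesis unfolding 0 unfolding e c using 2 B(3) by (simp add: tight_def)
  next
    case 3
    have e: "insert x B \<inter> (ground N1 \<union> V1) = B \<inter> (ground N1 \<union> V1)"
      "insert x B \<inter> ground N1 = B \<inter> ground N1" using 3 by auto
    show ?thesis unfolding 0 unfolding e using 3 B(3) by (simp add: tight_def N1.cl_def)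
  qed
qed

text \<open>By \<open>not_both_tight\<close> the second expansion admits every element, so the first
  one alone decides.\<close>

lemma insert_joint_if_tight:
  assumes B: "B \<in> indeps joint" "card B < k" "tight B" and x: "x \<in> E" "x \<notin> B"
  shows "insert x B \<in> indeps joint \<longleftrightarrow> x \<notin> V1 \<and> x \<notin> N1.cl (B \<inter> ground N1)"
proof -
  interpret sw: two_expansions N2 N1 V2 W2 V1 W1 E k by (rule two_expansions_swap)
  have BE: "B \<subseteq> E" using J.indeps_subset[OF B(1)] by simp
  have "insert x B \<in> indeps (expansion N2 V2 W2)"
    using B x not_both_tight[OF BE B(2,3)]
    by (intro sw.insert_expansion1_if_not_tight) (auto simp: indeps_joint)
  then show ?thesis
    using insert_expansion1_if_tight[OF _ B(2,3) x] B(1) by (auto simp: indeps_joint)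
qed

text \<open>As a flat, \<open>Z\<close> consists of \<open>B\<close> and the elements that cannot be
  added to \<open>B\<close>; by tightness the latter lie in \<open>V1\<close> or in
  \<open>F\<close>, the closure of \<open>B \<inter> ground N1\<close> in \<open>N1\<close>.\<close>

lemma proper_cyclic_flat_joint_tight:
  assumes Z: "is_cyclic_flat joint Z" "Z \<noteq> {}" "rank_on joint Z < k"
    and B: "B \<in> indeps joint" "B \<subseteq> Z" "card B = rank_on joint Z" and t: "tight B"
  shows "\<exists>F \<in> proper_cyclic_flats N1. Z = F \<union> V1"
proof -
  have flat: "\<And>x. x \<in> E - Z \<Longrightarrow> rank_on joint Z < rank_on joint (insert x Z)" and ZE: "Z \<subseteq> E"
    and cyc: "\<And>x. x \<in> Z \<Longrightarrow> rank_on joint (Z - {x}) = rank_on joint Z"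
    using Z(1) by (auto simp: J.is_cyclic_flat_iff is_flat_def)
  have finZ: "finite Z" using ZE finite_E by (rule finite_subset)
  have finB: "finite B" using B(2) finZ by (rule finite_subset)
  have Bk: "card B < k" using B Z by simp
  have Z_iff: "x \<in> Z \<longleftrightarrow> insert x B \<notin> indeps joint" if x: "x \<in> E" "x \<notin> B" for x
  proof
    assume xZ: "x \<in> Z"
    show "insert x B \<notin> indeps joint"
    proof
      assume "insert x B \<in> indeps joint"
      then have "card (insert x B) \<le> rank_on joint Z" using B xZ by (intro J.card_le_rank_on) auto
      then show False using x finB B by simp
    qed
  next
    assume n: "insert x B \<notin> indeps joint"
    show "x \<in> Z"
    proof (rule ccontr)
      assume "x \<notin> Z"
      then show False using J.rank_on_insert_eqI[OF B _ n] flat[of x] x by simp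
    qed
  qed
  have V1E: "V1 \<subseteq> E" and R1E: "ground N1 \<subseteq> E" using E1 by auto
  define F where "F = N1.cl (B \<inter> ground N1)"
  have BR: "B \<inter> ground N1 \<subseteq> ground N1" by auto
  have FR: "F \<subseteq> ground N1" unfolding F_def by (rule N1.cl_subset_ground)
  have BF: "B \<inter> ground N1 \<subseteq> F" unfolding F_def by (rule N1.subset_cl[OF BR])
  have mem: "x \<in> Z \<longleftrightarrow> x \<in> V1 \<union> F" if "x \<in> E" "x \<notin> B" for x
    using Z_iff[OF that] insert_joint_if_tight[OF B(1) Bk t that] by (auto simp: F_def)
  \<comment> \<open>If \<open>b\<close> were elsewhere, \<open>B - {b}\<close> would still be tight
    with the same closure. Cyclicity of \<open>Z\<close> supplies a \<open>y\<close> in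
    \<open>Z\<close> to replace \<open>b\<close>, which must then avoid \<open>V1\<close> and
    \<open>F\<close>, while \<open>mem\<close> puts it into one of them.\<close>
  have BW: "b \<in> ground N1 \<union> V1" if b: "b \<in> B" for b
  proof (rule ccontr)
    assume n: "b \<notin> ground N1 \<union> V1"
    let ?B = "B - {b}"
    have Bb: "?B \<in> indeps joint" by (rule J.indep_mono[OF B(1)]) auto
    have cb: "card B = Suc (card ?B)" using finB b by (rule card.remove)
    obtain A where A: "A \<in> indeps joint" "A \<subseteq> Z - {b}" "card A = rank_on joint (Z - {b})"
      by (rule J.rank_on_witness)
    then have "card ?B < card A" using cyc[of b] b B cb by (auto simp del: card_Diff_insert)
    then obtain y where y: "y \<in> A - ?B" "insert y ?B \<in> indeps joint"
      using J.indep_augment[OF Bb A(1)] by auto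
    then have y': "y \<in> Z" "y \<noteq> b" "y \<notin> B" "y \<in> E" using A ZE by auto
    have e: "?B \<inter> (ground N1 \<union> V1) = B \<inter> (ground N1 \<union> V1)" "?B \<inter> ground N1 = B \<inter> ground N1"
      using n by auto
    have t': "tight ?B" using t unfolding tight_def e .
    have "card ?B < k" using cb Bk by (simp del: card_Diff_insert)
    then have "y \<notin> V1 \<and> y \<notin> F"
      using insert_joint_if_tight[OF Bb _ t' y'(4)] y y' unfolding e F_def by auto
    then show False using mem[OF y'(4,3)] y'(1) by simp
  qed
  have ZF: "Z = F \<union> V1"
  proof
    show "Z \<subseteq> F \<union> V1"
      using mem BW BF ZE by blast
    show "F \<union> V1 \<subseteq> Z"
      using mem B(2) FR R1E V1E by blast
  qed
  have rank: "rank_on joint Z = rank_on N1 F + card V1" unfolding ZF by (rule rank_joint_Un_V1[OF FR])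
  have "is_cyclic_flat N1 F"
    unfolding N1.is_cyclic_flat_iff
  proof (intro conjI ballI)
    show "is_flat N1 F" unfolding F_def by (rule N1.is_flat_cl[OF BR])
    fix f assume f: "f \<in> F"
    then have "Z - {f} = (F - {f}) \<union> V1" using ZF FR disj1 by auto
    moreover have "rank_on joint ((F - {f}) \<union> V1) = rank_on N1 (F - {f}) + card V1"
      using FR by (intro rank_joint_Un_V1) auto
    ultimately show "rank_on N1 (F - {f}) = rank_on N1 F" using cyc[of f] f ZF rank by simp
  qed
  \<comment> \<open>Otherwise \<open>Z\<close> would be the independent set \<open>V1\<close>, and a
    nonempty independent set loses rank with every element removed.\<close>
  moreover have "F \<noteq> {}"
  proof
    assume "F = {}"
    then have ZV: "Z = V1" "rank_on joint Z = card V1"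
      using ZF rank N1.rank_on_le_card[of "{}"] by simp_all
    obtain v where v: "v \<in> Z" using Z by auto
    have "rank_on joint (Z - {v}) \<le> card (Z - {v})" using finZ by (intro J.rank_on_le_card) auto
    moreover have "card Z = Suc (card (Z - {v}))" using finZ v by (rule card.remove)
    ultimately show False using cyc[OF v] ZV by (simp del: card_Diff_insert)
  qed
  moreover have "F \<noteq> ground N1" using rank Z(3) k1 by auto
  ultimately show ?thesis using ZF by (auto simp: proper_cyclic_flats_def)
qed

text \<open>Cyclicity gives a maximum independent subset \<open>B\<close> of \<open>Z\<close> that
  misses some \<open>b\<close> in \<open>Z\<close>. One of the expansions refuses to add
  \<open>b\<close>, so \<open>B\<close> is tight for it.\<close>

lemma proper_cyclic_flat_joint:
  assumes Z: "is_cyclic_flat joint Z" "Z \<noteq> {}" "Z \<noteq> E"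
  shows "(\<exists>F \<in> proper_cyclic_flats N1. Z = F \<union> V1) \<or> (\<exists>F \<in> proper_cyclic_flats N2. Z = F \<union> V2)"
proof -
  interpret sw: two_expansions N2 N1 V2 W2 V1 W1 E k by (rule two_expansions_swap)
  have "Z \<in> proper_cyclic_flats joint" using Z by (simp add: proper_cyclic_flats_def)
  note Z' = J.proper_cyclic_flatD[OF this]
  have Zk: "rank_on joint Z < k" using Z'(6) rank_of_joint by simp
  obtain b where b: "b \<in> Z" using Z by auto
  obtain B where B: "B \<in> indeps joint" "B \<subseteq> Z - {b}" "card B = rank_on joint (Z - {b})"
    by (rule J.rank_on_witness)
  have B': "B \<subseteq> Z" "card B = rank_on joint Z" using B Z'(5)[OF b] by auto
  have Bk: "card B < k" using B' Zk by simp
  have bE: "b \<in> E" using Z'(1) b by auto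
  have "insert b B \<notin> indeps joint"
  proof
    assume "insert b B \<in> indeps joint"
    then have "card (insert b B) \<le> rank_on joint Z" using B' b by (intro J.card_le_rank_on) auto
    moreover have "b \<notin> B" using B by auto
    ultimately show False using B' J.finite_indep[OF B(1)] by simp
  qed
  then have "tight B \<or> sw.tight B"
    using insert_expansion1_if_not_tight[OF _ Bk _ bE] sw.insert_expansion1_if_not_tight[OF _ Bk _ bE] B(1)
    unfolding indeps_joint by blast
  then show ?thesis
    using proper_cyclic_flat_joint_tight[OF Z(1,2) Zk B(1) B']
      sw.proper_cyclic_flat_joint_tight[unfolded joint_swap, OF Z(1,2) Zk B(1) B'] by blast
qed

lemma cyclic_flats_joint:
  "{(Z, rank_on joint Z) | Z. is_cyclic_flat joint Z} =
    {({}, 0), (E, k)}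
    \<union> {(F \<union> V1, rank_on N1 F + card V1) | F. F \<in> proper_cyclic_flats N1}
    \<union> {(F \<union> V2, rank_on N2 F + card V2) | F. F \<in> proper_cyclic_flats N2}" (is "?L = ?R")
proof -
  interpret sw: two_expansions N2 N1 V2 W2 V1 W1 E k by (rule two_expansions_swap)
  have r0: "rank_on joint {} = 0" using J.rank_on_le_card[of "{}"] by simp
  have rk: "rank_on joint E = k" using rank_of_joint by simp
  have r1: "rank_on joint (F \<union> V1) = rank_on N1 F + card V1" if "F \<in> proper_cyclic_flats N1" for F
    by (rule rank_joint_Un_V1[OF N1.proper_cyclic_flatD(1)[OF that]])
  have r2: "rank_on joint (F \<union> V2) = rank_on N2 F + card V2" if "F \<in> proper_cyclic_flats N2" for F
    by (rule sw.rank_joint_Un_V1[unfolded joint_swap, OF N2.proper_cyclic_flatD(1)[OF that]])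
  have c2: "is_cyclic_flat joint (F \<union> V2)" if "F \<in> proper_cyclic_flats N2" for F
    by (rule sw.is_cyclic_flat_Un_V1[unfolded joint_swap, OF that])
  show ?thesis
  proof
    show "?L \<subseteq> ?R"
    proof
      fix p assume "p \<in> ?L"
      then obtain Z where Z: "p = (Z, rank_on joint Z)" "is_cyclic_flat joint Z" by blast
      show "p \<in> ?R"
      proof (cases "Z = {} \<or> Z = E")
        case True
        then show ?thesis using Z r0 rk by auto
      next
        case False
        then consider F where "F \<in> proper_cyclic_flats N1" "Z = F \<union> V1"
          | F where "F \<in> proper_cyclic_flats N2" "Z = F \<union> V2"
          using proper_cyclic_flat_joint[OF Z(2)] by blast
        then show ?thesis by cases (use Z r1 r2 in blast)+
      qed
    qed
    show "?R \<subseteq> ?L"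
      using r0 rk is_cyclic_flat_empty_joint is_cyclic_flat_ground_joint r1 r2 c2 is_cyclic_flat_Un_V1
      by (clarsimp, safe) (metis+)
  qed
qed

section \<open>The two minors, their uniqueness and minimality\<close>

lemma minor_by_V1_W1: "minor_by joint V1 W1 = N1"
proof (rule set_system.equality)
  show "ground (minor_by joint V1 W1) = ground N1"
    unfolding ground_minor_by ground_joint using E1 disj1 by auto
  then have "I \<in> indeps (minor_by joint V1 W1) \<longleftrightarrow> I \<in> indeps N1" for I
    using indep_Un_V1[of I] N1.indeps_subset[of I]
    unfolding indeps_minor_by ground_minor_by by auto
  then show "indeps (minor_by joint V1 W1) = indeps N1" by blast
qed simp

lemma V1_indep: "V1 \<in> indeps joint"
  using indep_Un_V1[of "{}"] N1.empty_indep by simp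

lemma has_minor_iso_N1: "has_minor_iso joint N1"
proof -
  have "minor_of (minor_by joint V1 W1) joint"
  proof (rule J.minor_of_minor_by[OF V1_indep])
    show "W1 \<subseteq> ground joint" unfolding ground_joint using E1 by auto
    show "V1 \<inter> W1 = {}" using disj1 by auto
  qed
  then show ?thesis unfolding minor_by_V1_W1 has_minor_iso_def using matroid_iso_refl by blast
qed

text \<open>A copy of \<open>N1\<close> has few elements, so at least one of \<open>V1\<close>, \<open>V2\<close> loses many elements by
  deletion, which makes the corresponding family of cyclic flats irrelevant.\<close>

lemma indep_expansion1_if_many_deleted:
  assumes "card (ground N1) \<le> card (V1 \<inter> Y)" "I \<inter> Y = {}" "I \<subseteq> E" "card I \<le> k"
  shows "I \<in> indeps (expansion N1 V1 W1)"
proof -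
  have "card (I \<inter> (ground N1 \<union> V1)) \<le> card (ground N1 \<union> (V1 - Y))"
    using assms(2) N1.finite_ground finite_V1 by (intro card_mono) auto
  also have "\<dots> \<le> card (ground N1) + card (V1 - Y)" by (rule card_Un_le)
  also have "\<dots> \<le> card V1" using assms(1) finite_V1 card_Int_Diff[of V1 Y] by simp
  finally show ?thesis using assms by (simp add: indeps_expansion1)
qed

lemma minor_by_joint_if_many_deleted:
  assumes "card (ground N1) \<le> card (V1 \<inter> Y)" "X \<inter> Y = {}"
  shows "minor_by joint X Y = minor_by (expansion N2 V2 W2) X Y"
proof (rule set_system.equality)
  interpret sw: two_expansions N2 N1 V2 W2 V1 W1 E k by (rule two_expansions_swap)
  have "I \<union> X \<in> indeps (expansion N1 V1 W1)"
    if "I \<subseteq> E - X - Y" "I \<union> X \<in> indeps (expansion N2 V2 W2)" for I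
    using that assms by (intro indep_expansion1_if_many_deleted) (auto simp: sw.indeps_expansion1)
  then show "indeps (minor_by joint X Y) = indeps (minor_by (expansion N2 V2 W2) X Y)"
    unfolding set_eq_iff indeps_minor_by indeps_joint ground_joint ground_expansion E2[symmetric] by blast
  show "ground (minor_by joint X Y) = ground (minor_by (expansion N2 V2 W2) X Y)"
    unfolding ground_minor_by ground_joint ground_expansion E2[symmetric] ..
qed simp

lemma minor_iso_N1_unique:
  assumes not_obt: "\<not> iso_obtainable_from N2 N1"
    and X: "X \<in> indeps joint" "card X + rank_of N1 = k" and Y: "Y \<subseteq> E" "X \<inter> Y = {}"
    and iso: "matroid_iso (minor_by joint X Y) N1"
  shows "X = V1 \<and> Y = W1"
proof -
  interpret sw: two_expansions N2 N1 V2 W2 V1 W1 E k by (rule two_expansions_swap)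
  have XE: "X \<subseteq> E" using J.indeps_subset[OF X(1)] by simp
  have fin: "finite X" "finite Y" using XE Y(1) finite_E by (auto intro: finite_subset)
  \<comment> \<open>Otherwise the copy of \<open>N1\<close> would be a minor of the expansion of
    \<open>N2\<close>, hence obtainable from \<open>N2\<close>.\<close>
  have not_small: "\<not> card (ground N1) \<le> card (V1 \<inter> Y)"
  proof
    assume "card (ground N1) \<le> card (V1 \<inter> Y)"
    then have eq: "minor_by joint X Y = minor_by (expansion N2 V2 W2) X Y"
      using Y(2) by (rule minor_by_joint_if_many_deleted)
    have "minor_of (minor_by (expansion N2 V2 W2) X Y) (expansion N2 V2 W2)"
    proof (rule matroid.minor_of_minor_by[OF sw.expansion1(1) _ _ Y(2)])
      show "X \<in> indeps (expansion N2 V2 W2)" using X(1) by (simp add: indeps_joint)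
      show "Y \<subseteq> ground (expansion N2 V2 W2)" using Y(1) by (simp add: E2)
    qed
    with sw.expansion1(2) have "obtainable_from N2 (minor_by (expansion N2 V2 W2) X Y)"
      by (rule obtainable_from.minor)
    then show False using not_obt iso eq unfolding iso_obtainable_from_def by auto
  qed
  \<comment> \<open>\<open>V1\<close> and \<open>V2\<close> together have
    \<open>2 * k - rank_of N1 - rank_of N2\<close> elements, but \<open>X\<close> has only
    \<open>k - rank_of N1\<close> and the copy only \<open>card (ground N1)\<close>. So
    \<open>Y\<close> must take many elements of \<open>V1\<close> or \<open>V2\<close>, and
    \<open>V1\<close> is excluded by \<open>not_small\<close>.\<close>
  have "card (ground N2) \<le> card (V2 \<inter> Y)"
  proof (rule ccontr)
    assume small2: "\<not> ?thesis"
    have P: "card (E - X - Y) = card (ground N1)" using matroid_iso_card_ground[OF iso] by simp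
    have "card V1 + card V2 = card (V1 \<union> V2)"
      using finite_V1 sw.finite_V1 VV by (intro card_Un_disjoint[symmetric])
    also have "\<dots> \<le> card (((V1 \<inter> Y) \<union> (V2 \<inter> Y)) \<union> (X \<union> (E - X - Y)))"
      using E1 E2 fin finite_E by (intro card_mono) auto
    also have "\<dots> \<le> card ((V1 \<inter> Y) \<union> (V2 \<inter> Y)) + card (X \<union> (E - X - Y))" by (rule card_Un_le)
    also have "\<dots> \<le> (card (V1 \<inter> Y) + card (V2 \<inter> Y)) + (card X + card (E - X - Y))"
      by (intro add_mono card_Un_le)
    finally show False
      using not_small small2 P X(2) k1 k2 big1 big2 rank_le_card by linarith
  qed
  then have eq: "minor_by joint X Y = minor_by (expansion N1 V1 W1) X Y"
    using sw.minor_by_joint_if_many_deleted[of Y X] Y(2) unfolding joint_swap by simp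
  show ?thesis
  proof (rule N1.expansion_minor_rigid[OF FI1 pos1 finite_V1 disj1(1) finite_W1 disj1(2)])
    show "X \<in> indeps (expansion N1 V1 W1)" using X(1) by (simp add: indeps_joint)
    show "card X = card V1" using X(2) k1 by simp
    show "Y \<subseteq> ground N1 \<union> V1 \<union> W1" using Y(1) E1 by simp
    show "matroid_iso (minor_by (expansion N1 V1 W1) X Y) N1" using iso eq by simp
  qed (rule Y(2))
qed

text \<open>Whatever a minor containing both copies has contracted lies in both \<open>V1\<close>
  and \<open>V2\<close>, and whatever it has deleted lies in both \<open>W1\<close> and
  \<open>W2\<close>; so nothing was removed.\<close>

lemma is_intertwine_joint:
  assumes not21: "\<not> iso_obtainable_from N2 N1" and not12: "\<not> iso_obtainable_from N1 N2"
  shows "is_intertwine joint N1 N2"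
  unfolding is_intertwine_def
proof (intro conjI notI)
  interpret sw: two_expansions N2 N1 V2 W2 V1 W1 E k by (rule two_expansions_swap)
  show "matroid joint" by (rule matroid_joint)
  show "has_minor_iso joint N1" by (rule has_minor_iso_N1)
  show "has_minor_iso joint N2" using sw.has_minor_iso_N1 unfolding joint_swap .
  assume "\<exists>M'. proper_minor_of M' joint \<and> has_minor_iso M' N1 \<and> has_minor_iso M' N2"
  then obtain M' where M': "minor_of M' joint" "M' \<noteq> joint" "has_minor_iso M' N1" "has_minor_iso M' N2"
    by (auto simp: proper_minor_of_def)
  obtain X Y where XY: "X \<in> indeps joint" "Y \<subseteq> ground joint" "X \<inter> Y = {}" "M' = minor_by joint X Y"
    "rank_of M' + card X = rank_of joint"
    by (rule J.minor_ofE[OF M'(1)])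
  interpret M': matroid M' unfolding XY(4) by (rule J.matroid_minor_by[OF XY(1)])
  \<comment> \<open>A copy inside \<open>M'\<close> is a copy inside \<open>joint\<close> whose
    contracted and deleted sets include \<open>X\<close> and \<open>Y\<close>, which makes
    uniqueness in \<open>joint\<close> applicable.\<close>
  have lift: "\<exists>X' Y'. X' \<in> indeps joint \<and> card X' + rank_of N = k \<and> Y' \<subseteq> E \<and> X' \<inter> Y' = {} \<and>
      matroid_iso (minor_by joint X' Y') N \<and> X \<subseteq> X' \<and> Y \<subseteq> Y'"
    if N: "matroid N" "has_minor_iso M' N" for N :: "'a set_system"
  proof -
    obtain X1 Y1 where 1: "X1 \<in> indeps M'" "Y1 \<subseteq> ground M'" "X1 \<inter> Y1 = {}"
      "matroid_iso (minor_by M' X1 Y1) N" "card X1 + rank_of N = rank_of M'"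
      by (rule M'.has_minor_isoE[OF N])
    have X1: "X1 \<subseteq> ground joint - X - Y" using M'.indeps_subset[OF 1(1)] XY(4) by simp
    have Y1: "Y1 \<subseteq> ground joint - X - Y" using 1(2) XY(4) by simp
    have ind: "X1 \<union> X \<in> indeps joint" using 1(1) XY(4) by (simp add: indeps_minor_by)
    have "card (X \<union> X1) = card X + card X1"
      using X1 J.finite_indep[OF ind] by (intro card_Un_disjoint) auto
    moreover have "minor_by M' X1 Y1 = minor_by joint (X \<union> X1) (Y \<union> Y1)"
      unfolding XY(4) by (rule minor_by_minor_by[OF X1])
    ultimately show ?thesis
      using ind 1 XY X1 Y1 rank_of_joint
      by (intro exI[of _ "X \<union> X1"] exI[of _ "Y \<union> Y1"]) (auto simp: Un_commute)
  qed
  have "X \<subseteq> V1 \<and> Y \<subseteq> W1"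
    using lift[OF N1.matroid_axioms M'(3)] minor_iso_N1_unique[OF not21] by metis
  moreover have "X \<subseteq> V2 \<and> Y \<subseteq> W2"
    using lift[OF N2.matroid_axioms M'(4)] sw.minor_iso_N1_unique[OF not12] unfolding joint_swap by metis
  ultimately have "X = {}" "Y = {}" using VV WW by auto
  then show False using M'(2) XY(4) J.minor_by_empty by simp
qed

end

text \<open>\<open>cyclic_flats_joint\<close> shows that \<open>joint\<close> fits the description,
  and \<open>matroid_eq_if_cyclic_flats_eq\<close> that nothing else does. The equations
  \<open>c\<close> split the two cardinalities into the summands used in the definition.\<close>

lemma M_construction_eq_joint:
  assumes "two_expansions N1 N2 (U1 \<union> A2) W1 (U2 \<union> A1) W2 (ground N1 \<union> ground N2 \<union> U1 \<union> U2) k"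
    and c: "card (U1 \<union> A2) = card U1 + card A2" "card (U2 \<union> A1) = card U2 + card A1"
  shows "M_construction k N1 A1 U1 N2 A2 U2 =
    two_expansions.joint N1 N2 (U1 \<union> A2) W1 (U2 \<union> A1) W2 (ground N1 \<union> ground N2 \<union> U1 \<union> U2)"
proof -
  interpret T: two_expansions N1 N2 "U1 \<union> A2" W1 "U2 \<union> A1" W2 "ground N1 \<union> ground N2 \<union> U1 \<union> U2" k
    by (rule assms(1))
  show ?thesis
    unfolding M_construction_def Let_def
  proof (rule the_equality)
    show joint: "matroid T.joint \<and> ground T.joint = ground N1 \<union> ground N2 \<union> U1 \<union> U2 \<and>
      {(Z, rank_on T.joint Z) | Z. is_cyclic_flat T.joint Z} =
         {({}, 0), (ground N1 \<union> ground N2 \<union> U1 \<union> U2, k)}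
         \<union> {(F \<union> U1 \<union> A2, rank_on N1 F + card U1 + card A2) | F. F \<in> proper_cyclic_flats N1}
         \<union> {(F \<union> U2 \<union> A1, rank_on N2 F + card U2 + card A1) | F. F \<in> proper_cyclic_flats N2}"
      using T.matroid_joint T.ground_joint T.cyclic_flats_joint
      unfolding c Un_assoc add.assoc by (intro conjI)
    fix M
    assume "matroid M \<and> ground M = ground N1 \<union> ground N2 \<union> U1 \<union> U2 \<and>
      {(Z, rank_on M Z) | Z. is_cyclic_flat M Z} =
         {({}, 0), (ground N1 \<union> ground N2 \<union> U1 \<union> U2, k)}
         \<union> {(F \<union> U1 \<union> A2, rank_on N1 F + card U1 + card A2) | F. F \<in> proper_cyclic_flats N1}
         \<union> {(F \<union> U2 \<union> A1, rank_on N2 F + card U2 + card A1) | F. F \<in> proper_cyclic_flats N2}"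
    then show "M = T.joint"
      using joint by (intro matroid_eq_if_cyclic_flats_eq) auto
  qed
qed

lemma M_construction_intertwine:
  assumes N1: "matroid N1" and N2: "matroid N2" and disj: "ground N1 \<inter> ground N2 = {}"
    and pos: "0 < rank_of N1" "0 < rank_of N2"
    and FI: "FI N1 = {}" "FI (dual_matroid N1) = {}" "FI N2 = {}" "FI (dual_matroid N2) = {}"
    and not_obt: "\<not> iso_obtainable_from N2 N1" "\<not> iso_obtainable_from N1 N2"
    and k: "4 * max (card (ground N1)) (card (ground N2)) \<le> k"
    and A: "A1 \<subseteq> ground N1" "A2 \<subseteq> ground N2"
    and U: "finite U1" "finite U2" "U1 \<inter> U2 = {}"
      "U1 \<inter> (ground N1 \<union> ground N2) = {}" "U2 \<inter> (ground N1 \<union> ground N2) = {}"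
    and card_U: "card U1 + rank_of N1 + card A2 = k" "card U2 + rank_of N2 + card A1 = k"
  shows "is_intertwine (M_construction k N1 A1 U1 N2 A2 U2) N1 N2"
    and "rank_of (M_construction k N1 A1 U1 N2 A2 U2) = k"
    and "ground (M_construction k N1 A1 U1 N2 A2 U2) = ground N1 \<union> ground N2 \<union> U1 \<union> U2"
proof -
  interpret N1: matroid N1 by (rule N1)
  interpret N2: matroid N2 by (rule N2)
  have finA: "finite A1" "finite A2"
    using A N1.finite_ground N2.finite_ground by (auto intro: finite_subset)
  have c: "card (U1 \<union> A2) = card U1 + card A2" "card (U2 \<union> A1) = card U2 + card A1"
    using A U finA by (auto intro!: card_Un_disjoint)
  \<comment> \<open>Each side contracts its own new elements and the chosen part of the other ground
    set; it deletes the other new elements and the unchosen part. This makes both the contracted and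
    the deleted sets disjoint.\<close>
  interpret T: two_expansions N1 N2 "U1 \<union> A2" "U2 \<union> (ground N2 - A2)" "U2 \<union> A1"
    "U1 \<union> (ground N1 - A1)" "ground N1 \<union> ground N2 \<union> U1 \<union> U2" k
  proof unfold_locales
    show "finite (ground N1 \<union> ground N2 \<union> U1 \<union> U2)"
      using U N1.finite_ground N2.finite_ground by simp
    show "card (U1 \<union> A2) + rank_of N1 = k" "card (U2 \<union> A1) + rank_of N2 = k"
      using c card_U by auto
    show "4 * card (ground N1) \<le> k" "4 * card (ground N2) \<le> k" using k by auto
  qed (use pos FI disj U A in auto)
  have eq: "M_construction k N1 A1 U1 N2 A2 U2 = T.joint"
    by (rule M_construction_eq_joint[OF T.two_expansions_axioms c])
  show "is_intertwine (M_construction k N1 A1 U1 N2 A2 U2) N1 N2"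
    unfolding eq by (rule T.is_intertwine_joint[OF not_obt])
  show "rank_of (M_construction k N1 A1 U1 N2 A2 U2) = k" unfolding eq by (rule T.rank_of_joint)
  show "ground (M_construction k N1 A1 U1 N2 A2 U2) = ground N1 \<union> ground N2 \<union> U1 \<union> U2"
    unfolding eq by simp
qed

theorem theorem4p1:
  fixes M1 M2 :: "'a set_system"
  assumes "matroid M1" and "matroid M2"
  shows
    "(\<forall>(M :: 'b set_system) k. is_intertwine M M1 M2 \<and> rank_of M = k \<longrightarrow>
        2 * int k - int (rank_of M1) - int (rank_of M2) \<le> int (card (ground M)) \<and>
        int (card (ground M)) \<le>
          2 * int k + int (rank_of (dual_matroid M1)) + int (rank_of (dual_matroid M2)))
     \<and>
     (infinite (UNIV :: 'a set) \<and>
      rank_of M1 > 0 \<and> rank_of M2 > 0 \<and> ground M1 \<inter> ground M2 = {} \<and>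
      \<not> iso_obtainable_from M2 M1 \<and> \<not> iso_obtainable_from M1 M2 \<and>
      FI M1 = {} \<and> FI (dual_matroid M1) = {} \<and> FI M2 = {} \<and> FI (dual_matroid M2) = {} \<longrightarrow>
      (\<forall>k m :: nat.
         k \<ge> 4 * max (card (ground M1)) (card (ground M2)) \<and>
         2 * int k - int (rank_of M1) - int (rank_of M2) \<le> int m \<and>
         int m \<le> 2 * int k + int (rank_of (dual_matroid M1)) + int (rank_of (dual_matroid M2)) \<longrightarrow>
         (\<exists>S1 S2. S1 \<subseteq> ground M1 \<and> S2 \<subseteq> ground M2 \<and>
            (\<forall>T1 T2. finite T1 \<and> finite T2 \<and>
               int (card T1) = int k - int (rank_of M1) - int (card S2) \<and>
               int (card T2) = int k - int (rank_of M2) - int (card S1) \<and>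
               T1 \<inter> T2 = {} \<and> T1 \<inter> (ground M1 \<union> ground M2) = {} \<and>
               T2 \<inter> (ground M1 \<union> ground M2) = {} \<longrightarrow>
               is_intertwine (M_construction k M1 S1 T1 M2 S2 T2) M1 M2 \<and>
               rank_of (M_construction k M1 S1 T1 M2 S2 T2) = k \<and>
               card (ground (M_construction k M1 S1 T1 M2 S2 T2)) = m))))"
proof (intro conjI allI impI, goal_cases)
  case (1 M k)
  then show ?case using intertwine_card_bounds(1)[OF assms, of M] by auto
next
  case (2 M k)
  then show ?case using intertwine_card_bounds(2)[OF assms, of M] by auto
next
  case (3 k m)
  interpret M1: matroid M1 by (rule assms)
  interpret M2: matroid M2 by (rule assms)
  let ?g1 = "card (ground M1)" and ?g2 = "card (ground M2)"
  \<comment> \<open>Rank and corank add up to the size of the ground set, which removes the duals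
    from the bounds on \<open>m\<close>.\<close>
  have m: "2 * k \<le> m + rank_of M1 + rank_of M2"
    "m + rank_of M1 + rank_of M2 \<le> 2 * k + ?g1 + ?g2"
    using 3(2) M1.rank_of_dual_matroid M2.rank_of_dual_matroid by linarith+
  \<comment> \<open>The ground set has \<open>?g1 + ?g2 + (k - rank_of M1 - card S2) + (k - rank_of
    M2 - card S1)\<close> elements; \<open>s\<close> is the value of
    \<open>card S1 + card S2\<close> that makes this equal to \<open>m\<close>.\<close>
  define s where "s = 2 * k + ?g1 + ?g2 - (m + rank_of M1 + rank_of M2)"
  have s: "s + (m + rank_of M1 + rank_of M2) = 2 * k + ?g1 + ?g2" "s \<le> ?g1 + ?g2"
    using m by (simp_all add: s_def)
  \<comment> \<open>As much of \<open>s\<close> as possible is taken from \<open>ground M1\<close>;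
    the rest fits into \<open>ground M2\<close> because \<open>s\<close> is at most
    \<open>?g1 + ?g2\<close>.\<close>
  obtain S1 where S1: "S1 \<subseteq> ground M1" "card S1 = min s ?g1"
    by (rule obtain_subset_with_card_n[of "min s ?g1" "ground M1"]) auto
  obtain S2 where S2: "S2 \<subseteq> ground M2" "card S2 = s - min s ?g1"
    by (rule obtain_subset_with_card_n[of "s - min s ?g1" "ground M2"]) (use s in auto)
  have cS: "card S1 + card S2 = s" using S1 S2 by simp
  show ?case
  proof (rule exI[of _ S1], rule exI[of _ S2], intro conjI[OF S1(1)] conjI[OF S2(1)] allI impI)
    fix T1 T2
    assume T: "finite T1 \<and> finite T2 \<and>
       int (card T1) = int k - int (rank_of M1) - int (card S2) \<and>
       int (card T2) = int k - int (rank_of M2) - int (card S1) \<and>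
       T1 \<inter> T2 = {} \<and> T1 \<inter> (ground M1 \<union> ground M2) = {} \<and>
       T2 \<inter> (ground M1 \<union> ground M2) = {}"
    then have cT: "card T1 + rank_of M1 + card S2 = k" "card T2 + rank_of M2 + card S1 = k"
      by linarith+
    have sep: "finite T1" "finite T2" "T1 \<inter> T2 = {}" "T1 \<inter> (ground M1 \<union> ground M2) = {}"
      "T2 \<inter> (ground M1 \<union> ground M2) = {}"
      using T by auto
    have main: "is_intertwine (M_construction k M1 S1 T1 M2 S2 T2) M1 M2"
      "rank_of (M_construction k M1 S1 T1 M2 S2 T2) = k"
      "ground (M_construction k M1 S1 T1 M2 S2 T2) = ground M1 \<union> ground M2 \<union> T1 \<union> T2"
      by (rule M_construction_intertwine[OF assms _ _ _ _ _ _ _ _ _ _ S1(1) S2(1) sep cT]; use 3 in simp)+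
    have "card (ground M1 \<union> ground M2 \<union> T1 \<union> T2) = card (ground M1 \<union> ground M2 \<union> T1) + card T2"
      using T M1.finite_ground M2.finite_ground by (intro card_Un_disjoint) auto
    also have "card (ground M1 \<union> ground M2 \<union> T1) = card (ground M1 \<union> ground M2) + card T1"
      using T M1.finite_ground M2.finite_ground by (intro card_Un_disjoint) auto
    also have "card (ground M1 \<union> ground M2) = ?g1 + ?g2"
      using 3 M1.finite_ground M2.finite_ground by (intro card_Un_disjoint) auto
    finally have "card (ground M1 \<union> ground M2 \<union> T1 \<union> T2) = m" using cT cS s(1) by linarith
    then show "is_intertwine (M_construction k M1 S1 T1 M2 S2 T2) M1 M2 \<and>
       rank_of (M_construction k M1 S1 T1 M2 S2 T2) = k \<and>
       card (ground (M_construction k M1 S1 T1 M2 S2 T2)) = m"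
      using main by simp
  qed
qed

end
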